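(* Let $\gamma<\zeta<\Lambda$ be ordinals and let $\psi$ be any $\mathsf{GLP}_\Lambda$ formula. Let $\tau$ be a set of worms such that $\langle\gamma\rangle\tau:=\{\langle\gamma\rangle A\mid A\in\tau\}$ consists of worms all of whose modalities are $<\zeta$, and such that $\langle\gamma\rangle\tau$ is $<_\gamma$-cofinal in $\langle\zeta\rangle\top$. Then \[\langle\zeta\rangle\psi\ \equiv_\gamma\ Q(\langle\gamma\rangle\tau,\psi),\] where $Q(\langle\gamma\rangle\tau,\psi):=\{Q(\langle\gamma\rangle A,\psi)\mid A\in\tau\}$.
   Context: $\mathsf{GLP}_\Lambda$ is the propositional polymodal logic with modalities $[\xi]$, $\xi<\Lambda$ ($\langle\xi\rangle:=\neg[\xi]\neg$), axiomatized by propositional tautologies; $[\xi](\varphi\to\chi)\to([\xi]\varphi\to[\xi]\chi)$; $[\xi]\varphi\to[\xi][\xi]\varphi$; $[\xi]([\xi]\varphi\to\varphi)\to[\xi]\varphi$; $\langle\zeta\rangle\varphi\to\langle\xi\rangle\varphi$ and $\langle\xi\rangle\varphi\to[\zeta]\langle\xi\rangle\varphi$ for $\xi<\zeta<\Lambda$; rules modus ponens and necessitation for each $[\xi]$. Worms: $\top$ is a worm; if $A$ is a worm and $\xi<\Lambda$ then $\langle\xi\rangle A$ is a worm. $Q(\top,\psi)=\top$, $Q(\langle\xi\rangle A,\psi)=\langle\xi\rangle(\psi\wedge Q(A,\psi))$. For worms, $A<_\gamma B$ iff $\vdash_{\mathsf{GLP}_\Lambda}B\to\langle\gamma\rangle A$;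 write $<$ for $<_0$. Let $o$ be the order isomorphism between (worms modulo $\mathsf{GLP}_\Lambda$-provable equivalence, $<_0$) and the ordinals. The $\gamma$-head $h_\gamma(A)$: $h_\gamma(\top)=\top$, $h_\gamma(\langle\xi\rangle A)=\langle\xi\rangle h_\gamma(A)$ if $\gamma\le\xi$, and $h_\gamma(\langle\xi\rangle A)=\top$ if $\xi<\gamma$. For a worm $A$ all of whose modalities are $\ge\gamma$, $\gamma\downarrow A$ replaces each $\langle\xi\rangle$ by $\langle-\gamma+\xi\rangle$ (where $-\gamma+\xi$ is the unique $\delta$ with $\gamma+\delta=\xi$). Set $o_\gamma(A):=o(\gamma\downarrow h_\gamma(A))$, and for a set $X$ of worms $o_\gamma(X):=\sup\{o_\gamma(C)\mid C\in X\}$. $X$ is $<_\gamma$-cofinal in a worm $A$ if $o_\gamma(X)=o_\gamma(A)$. For sets of formulas $\tau',\sigma$ (a formula identified with a singleton), $\tau'\vdash\chi$ means some finite conjunction of members provably implies $\chi$ in $\mathsf{GLP}_\Lambda$, and $\tau'\equiv_\gamma\sigma$ means: for every formula $\chi$, $\tau'\vdash\langle\gamma\rangle\chi$ iff $\sigma\vdash\langle\gamma\rangle\chi$. *)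

theory Defs
  imports Main
begin

text \<open>The ordinal \<open>\<Lambda>\<close> is given by a type \<open>'l\<close> of class \<open>wellorder\<close>: its elements are the ordinals
  below \<open>\<Lambda>\<close>, and every nonzero ordinal is the order type of such a type.\<close>

datatype 'l fm =
    Var nat
  | Bot
  | Imp "'l fm" "'l fm"
  | Box 'l "'l fm"

unbundle cardinal_syntax

definition Neg :: "'l fm \<Rightarrow> 'l fm" where
  "Neg \<phi> = Imp \<phi> Bot"

definition Top :: "'l fm" where
  "Top = Neg Bot"

definition And :: "'l fm \<Rightarrow> 'l fm \<Rightarrow> 'l fm" where
  "And \<phi> \<chi> = Neg (Imp \<phi> (Neg \<chi>))"

definition Dia :: "'l \<Rightarrow> 'l fm \<Rightarrow> 'l fm" where
  "Dia \<xi> \<phi> = Neg (Box \<xi> (Neg \<phi>))"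

definition Conj :: "'l fm list \<Rightarrow> 'l fm" where
  "Conj \<phi>s = foldr And \<phi>s Top"

text \<open>Propositional evaluation: variables and boxed formulas are the atoms, valued by \<open>v\<close>.\<close>

primrec pval :: "('l fm \<Rightarrow> bool) \<Rightarrow> 'l fm \<Rightarrow> bool" where
  "pval v (Var n) = v (Var n)"
| "pval v Bot = False"
| "pval v (Imp \<phi> \<chi>) = (pval v \<phi> \<longrightarrow> pval v \<chi>)"
| "pval v (Box \<xi> \<phi>) = v (Box \<xi> \<phi>)"

definition tautology :: "'l fm \<Rightarrow> bool" where
  "tautology \<phi> \<longleftrightarrow> (\<forall>v. pval v \<phi>)"

inductive GLP :: "'l::wellorder fm \<Rightarrow> bool" where
  taut: "tautology \<phi> \<Longrightarrow> GLP \<phi>"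
| dist: "GLP (Imp (Box \<xi> (Imp \<phi> \<chi>)) (Imp (Box \<xi> \<phi>) (Box \<xi> \<chi>)))"
| four: "GLP (Imp (Box \<xi> \<phi>) (Box \<xi> (Box \<xi> \<phi>)))"
| loeb: "GLP (Imp (Box \<xi> (Imp (Box \<xi> \<phi>) \<phi>)) (Box \<xi> \<phi>))"
| mono: "\<xi> < \<zeta> \<Longrightarrow> GLP (Imp (Dia \<zeta> \<phi>) (Dia \<xi> \<phi>))"
| neg_intro: "\<xi> < \<zeta> \<Longrightarrow> GLP (Imp (Dia \<xi> \<phi>) (Box \<zeta> (Dia \<xi> \<phi>)))"
| mp: "GLP (Imp \<phi> \<chi>) \<Longrightarrow> GLP \<phi> \<Longrightarrow> GLP \<chi>"
| nec: "GLP \<phi> \<Longrightarrow> GLP (Box \<xi> \<phi>)"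

definition entails :: "'l::wellorder fm set \<Rightarrow> 'l fm \<Rightarrow> bool" where
  "entails \<Gamma> \<chi> \<longleftrightarrow> (\<exists>\<phi>s. set \<phi>s \<subseteq> \<Gamma> \<and> GLP (Imp (Conj \<phi>s) \<chi>))"

definition equiv_dia :: "'l::wellorder \<Rightarrow> 'l fm set \<Rightarrow> 'l fm set \<Rightarrow> bool" where
  "equiv_dia \<gamma> \<Gamma> \<Delta> \<longleftrightarrow> (\<forall>\<chi>. entails \<Gamma> (Dia \<gamma> \<chi>) \<longleftrightarrow> entails \<Delta> (Dia \<gamma> \<chi>))"

datatype (modalities: 'l) worm = WTop | WDia 'l "'l worm"

primrec fm_of :: "'l worm \<Rightarrow> 'l fm" where
  "fm_of WTop = Top"
| "fm_of (WDia \<xi> A) = Dia \<xi> (fm_of A)"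

primrec Q :: "'l worm \<Rightarrow> 'l fm \<Rightarrow> 'l fm" where
  "Q WTop \<psi> = Top"
| "Q (WDia \<xi> A) \<psi> = Dia \<xi> (And \<psi> (Q A \<psi>))"

primrec head :: "'l::wellorder \<Rightarrow> 'l worm \<Rightarrow> 'l worm" where
  "head \<gamma> WTop = WTop"
| "head \<gamma> (WDia \<xi> A) = (if \<gamma> \<le> \<xi> then WDia \<xi> (head \<gamma> A) else WTop)"


text \<open>Ordinals that are not given as elements of \<open>'l\<close> are represented by well-orders up to
  \<open>=o\<close>. The ordinal of an element \<open>\<xi>\<close> of \<open>'l\<close> is the order type of its set of predecessors.\<close>

definition below :: "'l::wellorder \<Rightarrow> 'l rel" where
  "below \<xi> = {(a, b). a \<le> b \<and> b < \<xi>}"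

definition ord_sum :: "'a rel \<Rightarrow> 'b rel \<Rightarrow> ('a + 'b) rel" where
  "ord_sum r s = {(Inl a, Inl a') | a a'. (a, a') \<in> r} \<union> {(Inr b, Inr b') | b b'. (b, b') \<in> s}
     \<union> {(Inl a, Inr b) | a b. a \<in> Field r \<and> b \<in> Field s}"

text \<open>For \<open>\<gamma> \<le> \<xi>\<close>, the \<open>\<delta>\<close> with \<open>\<gamma> + \<delta> = \<xi>\<close> satisfies \<open>\<delta> \<le> \<xi>\<close>, so it is an element of \<open>'l\<close>; other
  arguments do not occur, since \<open>left_minus \<gamma>\<close> is only applied to modalities of \<open>\<gamma>\<close>-heads.\<close>

definition left_minus :: "'l::wellorder \<Rightarrow> 'l \<Rightarrow> 'l" where
  "left_minus \<gamma> \<xi> = (THE \<delta>. ord_sum (below \<gamma>) (below \<delta>) =o below \<xi>)"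

definition shift_down :: "'l::wellorder \<Rightarrow> 'l worm \<Rightarrow> 'l worm" where
  "shift_down \<gamma> A = map_worm (left_minus \<gamma>) A"

text \<open>Quantifying over well-orders \<open>t\<close> on the same type is no restriction: an ordinal smaller than
  that of \<open>r\<close> is the order type of an initial segment of \<open>r\<close>.\<close>

definition is_osup :: "'a rel set \<Rightarrow> 'a rel \<Rightarrow> bool" where
  "is_osup R r \<longleftrightarrow> Well_order r \<and> (\<forall>s\<in>R. s \<le>o r) \<and>
     (\<forall>t::'a rel. Well_order t \<and> (\<forall>s\<in>R. s \<le>o t) \<longrightarrow> r \<le>o t)"


definition worm_less :: "'l::wellorder \<Rightarrow> 'l worm \<Rightarrow> 'l worm \<Rightarrow> bool" where
  "worm_less \<gamma> A B \<longleftrightarrow> GLP (Imp (fm_of B) (Dia \<gamma> (fm_of A)))"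

definition worm_equiv :: "'l::wellorder worm \<Rightarrow> 'l worm \<Rightarrow> bool" where
  "worm_equiv A B \<longleftrightarrow> GLP (Imp (fm_of A) (fm_of B)) \<and> GLP (Imp (fm_of B) (fm_of A))"

definition worm_class :: "'l::wellorder worm \<Rightarrow> 'l worm set" where
  "worm_class A = {B. worm_equiv A B}"

definition ord_zero :: "'l::wellorder" where
  "ord_zero = (LEAST \<xi>. True)"

definition worm_order :: "'l::wellorder worm set rel" where
  "worm_order = {(worm_class A, worm_class B) | A B. worm_less ord_zero A B \<or> worm_equiv A B}"

text \<open>The order isomorphism of \<open>worm_order\<close> with an initial segment of the ordinals sends the class
  of \<open>A\<close> to the order type of the set of its strict predecessors; see \<open>worm_o_order_iso\<close> below.\<close>

definition worm_o :: "'l::wellorder worm \<Rightarrow> 'l worm set rel" where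
  "worm_o A = Restr worm_order (worm_class ` {B. worm_less ord_zero B A})"

definition worm_o_at :: "'l::wellorder \<Rightarrow> 'l worm \<Rightarrow> 'l worm set rel" where
  "worm_o_at \<gamma> A = worm_o (shift_down \<gamma> (head \<gamma> A))"

definition cofinal_in :: "'l::wellorder \<Rightarrow> 'l worm set \<Rightarrow> 'l worm \<Rightarrow> bool" where
  "cofinal_in \<gamma> X A \<longleftrightarrow> is_osup (worm_o_at \<gamma> ` X) (worm_o_at \<gamma> A)"


lemma GLP_trans: "GLP (Imp a b) \<Longrightarrow> GLP (Imp b c) \<Longrightarrow> GLP (Imp a c)"
  by (rule GLP.mp[OF GLP.mp[of "Imp a b" "Imp (Imp b c) (Imp a c)"]])
    (auto intro: GLP.taut simp: tautology_def)

lemma GLP_contrapos: "GLP (Imp a b) \<Longrightarrow> GLP (Imp (Neg b) (Neg a))"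
  by (rule GLP.mp[of "Imp a b"]) (auto intro: GLP.taut simp: tautology_def Neg_def)

lemma GLP_dia_mono: "GLP (Imp a b) \<Longrightarrow> GLP (Imp (Dia \<xi> a) (Dia \<xi> b))"
  unfolding Dia_def by (meson GLP_contrapos GLP.nec GLP.dist GLP.mp)

lemma worm_class_eq_iff: "worm_class A = worm_class B \<longleftrightarrow> worm_equiv A B"
proof -
  have "worm_equiv A A" for A :: "'a worm"
    by (auto simp: worm_equiv_def tautology_def intro: GLP.taut)
  then show ?thesis
    by (auto simp: worm_class_def worm_equiv_def intro: GLP_trans)
qed

lemma worm_less_cong:
  assumes "worm_equiv A A'" "worm_equiv B B'" "worm_less \<gamma> A B"
  shows "worm_less \<gamma> A' B'"
  using assms unfolding worm_equiv_def worm_less_def by (meson GLP_trans GLP_dia_mono)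

lemma worm_order_iff:
  "(worm_class A, worm_class B) \<in> worm_order \<longleftrightarrow> worm_less ord_zero A B \<or> worm_equiv A B"
proof
  assume "(worm_class A, worm_class B) \<in> worm_order"
  then obtain A' B' where "worm_class A = worm_class A'" "worm_class B = worm_class B'"
    "worm_less ord_zero A' B' \<or> worm_equiv A' B'"
    by (auto simp: worm_order_def)
  then show "worm_less ord_zero A B \<or> worm_equiv A B"
    by (metis worm_class_eq_iff worm_less_cong)
qed (auto simp: worm_order_def)

lemma worm_o_order_iso:
  assumes wo: "Well_order (worm_order :: 'l::wellorder worm set rel)"
    and irrefl: "\<And>A :: 'l worm. \<not> worm_less ord_zero A A"
  shows "worm_o (A :: 'l worm) =o worm_o B \<longleftrightarrow> worm_equiv A B"
    and "worm_o A <o worm_o B \<longleftrightarrow> worm_less ord_zero A B"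
    and "r <o worm_o A \<Longrightarrow> \<exists>C :: 'l worm. r =o worm_o C"
proof -
  let ?r = "worm_order :: 'l worm set rel"
  have wr: "wo_rel ?r" using wo by (simp add: wo_rel_def)
  note underS_ofilter = wo_rel.underS_ofilter[OF wr] and TOTALS = wo_rel.TOTALS[OF wr]
    and TRANS = wo_rel.TRANS[OF wr] and ANTISYM = wo_rel.ANTISYM[OF wr]
  have F: "worm_class C \<in> Field ?r" for C :: "'l worm"
    using worm_order_iff[of C C] worm_class_eq_iff[of C C] by (auto intro: FieldI1)
  have Fe: "\<exists>C. c = worm_class C" if "c \<in> Field ?r" for c
    using that by (auto simp: Field_def worm_order_def)
  have pred: "worm_class C \<in> underS ?r (worm_class D) \<longleftrightarrow> worm_less ord_zero C D" for C D :: "'l worm"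
  proof -
    have "\<not> worm_equiv C D" if "worm_less ord_zero C D"
      using irrefl[of D] worm_less_cong[of C D D D] that worm_class_eq_iff[of D D] by blast
    then show ?thesis
      by (auto simp: underS_def worm_order_iff worm_class_eq_iff)
  qed
  have "worm_class ` {B. worm_less ord_zero B C} = underS ?r (worm_class C)" for C :: "'l worm"
  proof
    show "worm_class ` {B. worm_less ord_zero B C} \<subseteq> underS ?r (worm_class C)"
      using pred by blast
    show "underS ?r (worm_class C) \<subseteq> worm_class ` {B. worm_less ord_zero B C}"
    proof
      fix c assume c: "c \<in> underS ?r (worm_class C)"
      then have "c \<in> Field ?r"
        by (auto simp: underS_def intro: FieldI1)
      then obtain B where "c = worm_class B"
        using Fe by blast
      with c pred show "c \<in> worm_class ` {B. worm_less ord_zero B C}"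
        by blast
    qed
  qed
  then have o: "worm_o C = Restr ?r (underS ?r (worm_class C))" for C :: "'l worm"
    by (simp add: worm_o_def)
  have woo: "Well_order (worm_o C)" for C :: "'l worm"
    unfolding o by (rule Well_order_Restr[OF wo])
  have lt: "worm_o C <o worm_o D" if less: "worm_less ord_zero C D" for C D :: "'l worm"
  proof -
    have CD: "worm_class C \<in> underS ?r (worm_class D)"
      using less pred by blast
    then have "underS ?r (worm_class C) \<subseteq> underS ?r (worm_class D)"
      using underS_incr[OF TRANS ANTISYM] by (simp add: underS_def)
    moreover have "worm_class C \<notin> underS ?r (worm_class C)"
      by (simp add: underS_def)
    ultimately have "underS ?r (worm_class C) \<subset> underS ?r (worm_class D)"
      using CD by blast
    then show ?thesis
      unfolding o using ofilter_subset_ordLess[OF wo underS_ofilter underS_ofilter] by blast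
  qed
  have eq: "worm_o C =o worm_o D" if "worm_equiv C D" for C D :: "'l worm"
    using ordIso_reflexive[OF woo] that o worm_class_eq_iff by metis
  have tri: "worm_less ord_zero C D \<or> worm_equiv C D \<or> worm_less ord_zero D C" for C D :: "'l worm"
    using TOTALS F[of C] F[of D] worm_order_iff[of C D] worm_order_iff[of D C]
    by (auto simp: worm_equiv_def)
  show "worm_o A =o worm_o B \<longleftrightarrow> worm_equiv A B"
    using eq lt tri by (meson not_ordLess_ordIso ordIso_symmetric)
  show "worm_o A <o worm_o B \<longleftrightarrow> worm_less ord_zero A B"
    using eq lt tri by (metis not_ordLess_ordIso ordLess_transitive ordLess_irreflexive)
  show "\<exists>C :: 'l worm. r =o worm_o C" if r: "r <o worm_o A"
  proof -
    have "worm_o A <o ?r"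
      unfolding o using F underS_Restr_ordLess[OF wo] by blast
    with r have "r <o ?r" by (rule ordLess_transitive)
    moreover have "Well_order r" using r by (auto simp: ordLess_def)
    ultimately obtain c where "c \<in> Field ?r" "r =o Restr ?r (underS ?r c)"
      using ordLess_iff_ordIso_Restr[OF wo] by blast
    with Fe o show ?thesis by metis
  qed
qed

end

theory Submission
  imports Defs
begin

text \<open>
  From \<open>\<langle>\<zeta>\<rangle>\<psi>\<close> every \<open>Q(B, \<psi>)\<close> with modalities below \<open>\<zeta>\<close> follows by induction on \<open>B\<close>. For the converse,
  suppose that \<open>\<langle>\<gamma>\<rangle>\<chi>\<close> follows from no \<open>Q(\<langle>\<eta>\<rangle>\<^sup>k\<top>, \<psi>)\<close> with \<open>\<gamma> \<le> \<eta> < \<zeta>\<close>. Compactness and a pigeonhole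
  argument along \<open>\<eta>\<close>-chains then give a maximal consistent set \<open>y\<close> containing \<open>\<psi>\<close>, \<open>[\<gamma>]\<not>\<chi>\<close> and all
  \<open>[\<xi>]\<phi> \<rightarrow> \<phi>\<close> with \<open>\<xi> < \<zeta>\<close>. A new point that has the same \<open>\<xi>\<close>-successors as \<open>y\<close> for \<open>\<xi> < \<zeta>\<close>, the
  \<open>\<zeta>\<close>-successors of \<open>y\<close> together with \<open>y\<close> itself as \<open>\<zeta>\<close>-successors, and nothing above \<open>\<zeta>\<close>, satisfies
  all theorems of GLP, and it refutes \<open>\<langle>\<zeta>\<rangle>\<psi> \<rightarrow> \<langle>\<gamma>\<rangle>\<chi>\<close>.

  So \<open>\<langle>\<gamma>\<rangle>\<chi>\<close> follows from some \<open>Q(\<langle>\<eta>\<rangle>\<^sup>k\<top>, \<psi>)\<close>. By cofinality some \<open>A \<in> \<tau>\<close> has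
  \<open>o\<^sub>\<gamma>(\<langle>\<gamma>\<rangle>A) > o\<^sub>\<gamma>(\<langle>\<eta>\<rangle>\<^sup>k\<top>)\<close>, which is a provable implication between worms; relativizing it to \<open>\<psi>\<close>
  yields the implication between the corresponding \<open>Q\<close>-formulas. Reading the order back as provability
  needs the consistency of \<open>\<langle>\<eta>\<rangle>\<^sup>k\<top>\<close>; it comes from iterating the same one-point extension.
\<close>

section \<open>Propositional reasoning inside GLP\<close>

lemma pval_simps [simp]:
  "pval v Top" "pval v (Neg \<phi>) \<longleftrightarrow> \<not> pval v \<phi>"
  "pval v (And \<phi> \<chi>) \<longleftrightarrow> pval v \<phi> \<and> pval v \<chi>"
  "pval v (Dia \<xi> \<phi>) \<longleftrightarrow> \<not> v (Box \<xi> (Neg \<phi>))"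
  "pval v (Conj l) \<longleftrightarrow> (\<forall>\<phi>\<in>set l. pval v \<phi>)"
proof -
  show "pval v (Conj l) \<longleftrightarrow> (\<forall>\<phi>\<in>set l. pval v \<phi>)"
    by (induction l) (simp_all add: Conj_def Top_def Neg_def And_def)
qed (simp_all add: Top_def Neg_def And_def Dia_def)

lemma GLP_tautI: "(\<And>v. pval v \<phi>) \<Longrightarrow> GLP \<phi>"
  by (simp add: GLP.taut tautology_def)

lemma GLP_taut1: "GLP \<phi> \<Longrightarrow> (\<And>v. pval v \<phi> \<Longrightarrow> pval v \<chi>) \<Longrightarrow> GLP \<chi>"
  by (rule GLP.mp[of \<phi>]) (simp_all add: GLP_tautI)

lemma GLP_taut2:
  "GLP \<phi> \<Longrightarrow> GLP \<chi> \<Longrightarrow> (\<And>v. pval v \<phi> \<Longrightarrow> pval v \<chi> \<Longrightarrow> pval v \<theta>) \<Longrightarrow> GLP \<theta>"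
  by (rule GLP.mp[of \<chi>], rule GLP.mp[of \<phi>]) (simp_all add: GLP_tautI)

lemma GLP_box_mono: "GLP (Imp \<phi> \<chi>) \<Longrightarrow> GLP (Imp (Box \<xi> \<phi>) (Box \<xi> \<chi>))"
  using GLP.dist GLP.mp GLP.nec by blast

subsection \<open>Maximal consistent sets\<close>

definition mcs :: "'l::wellorder fm set \<Rightarrow> bool" where
  "mcs x \<longleftrightarrow> (\<forall>\<phi>. GLP \<phi> \<longrightarrow> \<phi> \<in> x) \<and> Bot \<notin> x \<and> (\<forall>\<phi> \<chi>. Imp \<phi> \<chi> \<in> x \<longleftrightarrow> (\<phi> \<in> x \<longrightarrow> \<chi> \<in> x))"

lemma mcs_GLP: "mcs x \<Longrightarrow> GLP \<phi> \<Longrightarrow> \<phi> \<in> x"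
  by (simp add: mcs_def)

lemma mcs_simps [simp]:
  assumes "mcs x"
  shows "Bot \<notin> x" "Imp \<phi> \<chi> \<in> x \<longleftrightarrow> (\<phi> \<in> x \<longrightarrow> \<chi> \<in> x)" "Neg \<phi> \<in> x \<longleftrightarrow> \<phi> \<notin> x"
    "Top \<in> x" "And \<phi> \<chi> \<in> x \<longleftrightarrow> \<phi> \<in> x \<and> \<chi> \<in> x" "Dia \<xi> \<phi> \<in> x \<longleftrightarrow> Box \<xi> (Neg \<phi>) \<notin> x"
    "Conj l \<in> x \<longleftrightarrow> set l \<subseteq> x"
proof -
  show "Conj l \<in> x \<longleftrightarrow> set l \<subseteq> x"
    using assms by (induction l) (auto simp add: Conj_def Top_def Neg_def And_def mcs_def)
qed (use assms in \<open>auto simp add: Top_def Neg_def And_def Dia_def mcs_def\<close>)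

lemma mcs_mp: "mcs x \<Longrightarrow> GLP (Imp \<phi> \<chi>) \<Longrightarrow> \<phi> \<in> x \<Longrightarrow> \<chi> \<in> x"
  using mcs_GLP mcs_simps(2) by blast

lemma mcs_box_mono: "mcs x \<Longrightarrow> GLP (Imp \<phi> \<chi>) \<Longrightarrow> Box \<xi> \<phi> \<in> x \<Longrightarrow> Box \<xi> \<chi> \<in> x"
  using GLP_box_mono mcs_mp by blast

lemma mcs_box_mono2:
  assumes "mcs x" "GLP (Imp \<phi> (Imp \<chi> \<theta>))" "Box \<xi> \<phi> \<in> x" "Box \<xi> \<chi> \<in> x"
  shows "Box \<xi> \<theta> \<in> x"
  using mcs_mp[OF assms(1) GLP.dist] mcs_box_mono assms mcs_simps(2) by blast

lemma mcs_four: "mcs x \<Longrightarrow> Box \<xi> \<phi> \<in> x \<Longrightarrow> Box \<xi> (Box \<xi> \<phi>) \<in> x"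
  using GLP.four mcs_mp by blast

lemma mcs_box_up:
  assumes "mcs x" "\<xi> \<le> \<zeta>" "Box \<xi> \<phi> \<in> x"
  shows "Box \<zeta> \<phi> \<in> x"
proof (cases "\<xi> = \<zeta>")
  case False
  then have *: "Imp (Dia \<zeta> (Neg \<phi>)) (Dia \<xi> (Neg \<phi>)) \<in> x"
    using assms by (simp add: GLP.mono mcs_GLP del: mcs_simps)
  have nn: "GLP (Imp \<phi> (Neg (Neg \<phi>)))" "GLP (Imp (Neg (Neg \<phi>)) \<phi>)"
    by (auto intro: GLP_tautI)
  show ?thesis
    using * assms mcs_box_mono[OF assms(1) nn(1)] mcs_box_mono[OF assms(1) nn(2)] by auto
qed (use assms in simp)

lemma mcs_not_box_up:
  assumes "mcs x" "\<xi> < \<zeta>" "Box \<xi> \<phi> \<notin> x"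
  shows "Box \<zeta> (Neg (Box \<xi> \<phi>)) \<in> x"
proof -
  have nn: "GLP (Imp \<phi> (Neg (Neg \<phi>)))" "GLP (Imp (Neg (Neg \<phi>)) \<phi>)"
    by (auto intro: GLP_tautI)
  have "Dia \<xi> (Neg \<phi>) \<in> x"
    using assms mcs_box_mono[OF assms(1) nn(2)] by auto
  then have "Box \<zeta> (Dia \<xi> (Neg \<phi>)) \<in> x"
    using mcs_mp[OF assms(1) GLP.neg_intro[OF assms(2)]] by blast
  moreover have "GLP (Imp (Dia \<xi> (Neg \<phi>)) (Neg (Box \<xi> \<phi>)))"
    by (rule GLP_taut1[OF GLP_box_mono[OF nn(1), of \<xi>]]) auto
  ultimately show ?thesis
    using mcs_box_mono[OF assms(1)] by blast
qed

section \<open>Finitary entailment and maximal extensions\<close>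

lemma entails_mem: "\<phi> \<in> S \<Longrightarrow> entails S \<phi>"
  unfolding entails_def by (intro exI[of _ "[\<phi>]"]) (auto intro: GLP_tautI)

lemma entails_GLP: "GLP \<phi> \<Longrightarrow> entails S \<phi>"
  unfolding entails_def by (intro exI[of _ "[]"]) (auto intro: GLP_taut1)

lemma entails_mp:
  assumes "entails S (Imp \<phi> \<chi>)" "entails S \<phi>"
  shows "entails S \<chi>"
proof -
  obtain k l where "set k \<subseteq> S" "GLP (Imp (Conj k) (Imp \<phi> \<chi>))" "set l \<subseteq> S" "GLP (Imp (Conj l) \<phi>)"
    using assms by (auto simp: entails_def)
  then show ?thesis
    unfolding entails_def
    by (intro exI[of _ "k @ l"]) (auto elim!: GLP_taut2[of "Imp (Conj k) (Imp \<phi> \<chi>)" "Imp (Conj l) \<phi>"])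
qed

lemma entails_Imp:
  assumes "entails (insert \<phi> S) \<chi>"
  shows "entails S (Imp \<phi> \<chi>)"
proof -
  obtain l where l: "set l \<subseteq> insert \<phi> S" "GLP (Imp (Conj l) \<chi>)"
    using assms by (auto simp: entails_def)
  have "GLP (Imp (Conj (filter (\<lambda>\<theta>. \<theta> \<noteq> \<phi>) l)) (Imp \<phi> \<chi>))"
    by (rule GLP_taut1[OF l(2)]) auto
  with l(1) show ?thesis
    unfolding entails_def by (intro exI[of _ "filter (\<lambda>\<theta>. \<theta> \<noteq> \<phi>) l"]) auto
qed

lemma entails_subset: "entails S \<chi> \<Longrightarrow> S \<subseteq> T \<Longrightarrow> entails T \<chi>"
  by (auto simp: entails_def)

text \<open>Zorn's lemma is used because the language may be uncountable. The union of a chain stays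
  consistent since an entailment uses only a finite list of premises, which already lies in one
  member.\<close>

lemma Lindenbaum:
  assumes S: "\<not> entails S Bot"
  obtains x where "mcs x" "S \<subseteq> x"
proof -
  define F where "F = {T. S \<subseteq> T \<and> \<not> entails T Bot}"
  have "\<exists>x\<in>F. \<forall>T\<in>F. x \<subseteq> T \<longrightarrow> T = x"
  proof (rule subset_Zorn_nonempty)
    show "F \<noteq> {}"
      using S by (auto simp: F_def)
    fix \<C> assume \<C>: "\<C> \<noteq> {}" "subset.chain F \<C>"
    have "\<not> entails (\<Union>\<C>) Bot"
    proof
      assume "entails (\<Union>\<C>) Bot"
      then obtain l where l: "set l \<subseteq> \<Union>\<C>" "GLP (Imp (Conj l) Bot)"
        by (auto simp: entails_def)
      then obtain T where "T \<in> \<C>" "set l \<subseteq> T"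
        using finite_subset_Union_chain[OF _ l(1) \<C>] by blast
      with l(2) have "entails T Bot" "T \<in> F"
        using \<C>(2) by (auto simp: entails_def subset_chain_def)
      then show False
        by (simp add: F_def)
    qed
    then show "\<Union>\<C> \<in> F"
      using \<C> by (fastforce simp: F_def subset_chain_def)
  qed
  then obtain x where x: "S \<subseteq> x" "\<not> entails x Bot"
    and max: "\<And>T. x \<subseteq> T \<Longrightarrow> \<not> entails T Bot \<Longrightarrow> T = x"
    by (auto simp: F_def)
  have neg: "entails x (Imp \<phi> Bot)" if "\<phi> \<notin> x" for \<phi>
    using max[of "insert \<phi> x"] that entails_Imp by blast
  have cl: "\<phi> \<in> x \<longleftrightarrow> entails x \<phi>" for \<phi>
    using neg entails_mp x(2) entails_mem by blast
  have "Imp \<phi> \<chi> \<in> x \<longleftrightarrow> (\<phi> \<in> x \<longrightarrow> \<chi> \<in> x)" for \<phi> \<chi>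
  proof -
    have "entails x (Imp \<phi> \<chi>)" if "\<phi> \<notin> x"
      by (rule entails_mp[OF entails_GLP neg[OF that]]) (auto intro: GLP_tautI)
    moreover have "entails x (Imp \<phi> \<chi>)" if "\<chi> \<in> x"
      by (rule entails_mp[OF entails_GLP entails_mem[OF that]]) (auto intro: GLP_tautI)
    ultimately show ?thesis
      using cl entails_mp by blast
  qed
  then have "mcs x"
    using x(2) cl by (auto simp: mcs_def intro: entails_GLP)
  with x(1) show ?thesis
    using that by blast
qed

lemma mcs_entails: "mcs x \<Longrightarrow> entails x \<chi> \<Longrightarrow> \<chi> \<in> x"
  unfolding entails_def by (metis mcs_mp mcs_simps(7))

lemma GLP_iff_mcs: "GLP \<phi> \<longleftrightarrow> (\<forall>x. mcs x \<longrightarrow> \<phi> \<in> x)"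
proof (rule iffI, use mcs_GLP in blast, rule ccontr)
  assume all: "\<forall>x. mcs x \<longrightarrow> \<phi> \<in> x" and "\<not> GLP \<phi>"
  have "\<not> entails {Neg \<phi>} Bot"
  proof
    assume "entails {Neg \<phi>} Bot"
    then obtain l where l: "set l \<subseteq> {Neg \<phi>}" "GLP (Imp (Conj l) Bot)"
      by (auto simp: entails_def)
    have "GLP \<phi>"
      by (rule GLP_taut1[OF l(2)]) (use l(1) in auto)
    with \<open>\<not> GLP \<phi>\<close> show False by simp
  qed
  then obtain x where "mcs x" "{Neg \<phi>} \<subseteq> x"
    by (rule Lindenbaum)
  with all show False by auto
qed

section \<open>Canonical successor relations\<close>

definition sees :: "'l::wellorder \<Rightarrow> 'l fm set \<Rightarrow> 'l fm set \<Rightarrow> bool" where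
  "sees \<xi> x y \<longleftrightarrow> mcs y \<and> (\<forall>\<phi>. Box \<xi> \<phi> \<in> x \<longrightarrow> \<phi> \<in> y)"

lemma sees_trans: "mcs x \<Longrightarrow> sees \<xi> x y \<Longrightarrow> sees \<xi> y z \<Longrightarrow> sees \<xi> x z"
  unfolding sees_def by (meson mcs_four)

lemma mcs_box_iff_sees:
  assumes "mcs x"
  shows "Box \<xi> \<phi> \<in> x \<longleftrightarrow> (\<forall>y. sees \<xi> x y \<longrightarrow> \<phi> \<in> y)"
proof (rule iffI, use sees_def in blast, rule ccontr)
  assume all: "\<forall>y. sees \<xi> x y \<longrightarrow> \<phi> \<in> y" and no: "Box \<xi> \<phi> \<notin> x"
  let ?S = "insert (Neg \<phi>) {\<chi>. Box \<xi> \<chi> \<in> x}"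
  have "\<not> entails ?S Bot"
  proof
    assume "entails ?S Bot"
    then have "entails {\<chi>. Box \<xi> \<chi> \<in> x} (Imp (Neg \<phi>) Bot)"
      by (rule entails_Imp)
    then obtain l where l: "set l \<subseteq> {\<chi>. Box \<xi> \<chi> \<in> x}" "GLP (Imp (Conj l) (Imp (Neg \<phi>) Bot))"
      by (auto simp: entails_def)
    have "Box \<xi> (Conj l) \<in> x"
      using l(1)
    proof (induction l)
      case Nil
      show ?case
        using mcs_GLP[OF assms GLP.nec[OF GLP_tautI]] by (simp add: Conj_def)
    next
      case (Cons \<chi> l)
      have "GLP (Imp \<chi> (Imp (Conj l) (Conj (\<chi> # l))))"
        by (auto intro: GLP_tautI)
      then show ?case
        using mcs_box_mono2[OF assms] Cons by auto
    qed
    moreover have "GLP (Imp (Conj l) \<phi>)"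
      by (rule GLP_taut1[OF l(2)]) auto
    ultimately show False
      using no mcs_box_mono[OF assms] by blast
  qed
  then obtain y where "mcs y" "?S \<subseteq> y"
    by (rule Lindenbaum)
  with all show False
    by (auto simp: sees_def)
qed

lemma mcs_dia_iff_sees: "mcs x \<Longrightarrow> Dia \<xi> \<phi> \<in> x \<longleftrightarrow> (\<exists>y. sees \<xi> x y \<and> \<phi> \<in> y)"
  using mcs_box_iff_sees[of x \<xi> "Neg \<phi>"] by (auto simp: sees_def)

text \<open>Both outcomes are stored under \<open>Box \<zeta>\<close>: a lower box by transitivity
  and monotonicity, its negation by \<open>mcs_not_box_up\<close>.\<close>

lemma sees_box_iff:
  assumes "mcs x" "sees \<zeta> x y" "\<xi> < \<zeta>"
  shows "Box \<xi> \<phi> \<in> y \<longleftrightarrow> Box \<xi> \<phi> \<in> x"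
  using assms mcs_not_box_up[OF assms(1,3), of \<phi>] mcs_box_up[OF assms(1), of \<xi> \<zeta> "Box \<xi> \<phi>"]
    mcs_four[OF assms(1), of \<xi> \<phi>] unfolding sees_def by force

text \<open>A new point that sees, via \<open>\<zeta>\<close>, exactly the sets in \<open>Y\<close> and their \<open>\<zeta>\<close>-successors, copies the
  sets in \<open>Y\<close> below \<open>\<zeta>\<close>, and sees nothing above \<open>\<zeta>\<close> is again maximal consistent.\<close>

lemma mcs_extension:
  assumes Y: "\<And>y. y \<in> Y \<Longrightarrow> mcs y" "y0 \<in> Y"
    and agree: "\<And>\<xi> \<phi> y y'. \<xi> < \<zeta> \<Longrightarrow> y \<in> Y \<Longrightarrow> y' \<in> Y \<Longrightarrow> Box \<xi> \<phi> \<in> y \<Longrightarrow> Box \<xi> \<phi> \<in> y'"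
    and refl: "\<And>\<xi> \<phi> y. \<xi> < \<zeta> \<Longrightarrow> y \<in> Y \<Longrightarrow> Box \<xi> \<phi> \<in> y \<Longrightarrow> \<phi> \<in> y"
  obtains x where "mcs x" "\<And>\<xi> \<phi>. \<xi> < \<zeta> \<Longrightarrow> Box \<xi> \<phi> \<in> x \<longleftrightarrow> Box \<xi> \<phi> \<in> y0"
    "\<And>\<phi>. Box \<zeta> \<phi> \<in> x \<longleftrightarrow> (\<forall>y\<in>Y. \<phi> \<in> y \<and> Box \<zeta> \<phi> \<in> y)"
proof -
  \<comment> \<open>Boxes are propositional atoms, so a valuation of them determines the new point.
    Above \<zeta> nothing is seen, hence all boxes hold; the value on variables is
    arbitrary.\<close>
  define v where "v \<theta> = (case \<theta> of Box \<xi> \<phi> \<Rightarrow>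
    if \<xi> < \<zeta> then Box \<xi> \<phi> \<in> y0 else if \<xi> = \<zeta> then \<forall>y\<in>Y. \<phi> \<in> y \<and> Box \<zeta> \<phi> \<in> y else True | _ \<Rightarrow> True)" for \<theta>
  have v [simp]: "v (Box \<xi> \<phi>) \<longleftrightarrow>
    (if \<xi> < \<zeta> then Box \<xi> \<phi> \<in> y0 else if \<xi> = \<zeta> then \<forall>y\<in>Y. \<phi> \<in> y \<and> Box \<zeta> \<phi> \<in> y else True)" for \<xi> \<phi>
    by (simp add: v_def)
  have y0: "mcs y0"
    using Y by blast
  have snd: "pval v \<phi>" if "GLP \<phi>" for \<phi>
    using that
  proof (induction rule: GLP.induct)
    case (dist \<xi> \<phi> \<chi>)
    show ?case
      using mcs_GLP[OF _ GLP.dist[of \<xi> \<phi> \<chi>]] y0 Y by auto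
  next
    case (four \<xi> \<phi>)
    show ?case
      using mcs_four[OF y0, of \<xi> \<phi>] mcs_four[OF Y(1), of _ \<xi> \<phi>] by auto
  next
    \<comment> \<open>For \<xi> = \<zeta> the premise puts both
      \<open>Imp (Box \<zeta> \<phi>) \<phi>\<close> and its \<open>\<zeta>\<close>-box into each
      \<open>y\<close>. Loeb's axiom in \<open>y\<close> turns the latter into
      \<open>Box \<zeta> \<phi>\<close>, and the former then gives \<phi>.\<close>
    case (loeb \<xi> \<phi>)
    show ?case
      using mcs_GLP[OF _ GLP.loeb[of \<xi> \<phi>]] y0 Y by auto
  next
    case (mono \<xi> \<xi>' \<phi>)
    have "v (Box \<xi>' \<theta>)" if v\<theta>: "v (Box \<xi> \<theta>)" for \<theta>
    proof (cases "\<xi>' \<le> \<zeta>")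
      case True
      with mono v\<theta> have 0: "Box \<xi> \<theta> \<in> y0" and \<xi>: "\<xi> < \<zeta>"
        by auto
      have "Box \<xi>' \<theta> \<in> y \<and> \<theta> \<in> y" if "y \<in> Y" for y
        using agree[OF \<xi> Y(2) that 0] refl[OF \<xi> that] mcs_box_up[OF Y(1)[OF that] less_imp_le[OF mono]] by blast
      then show ?thesis
        using True Y(2) by auto
    qed auto
    then show ?case by (auto simp del: v)
  next
    case (neg_intro \<xi> \<xi>' \<phi>)
    have eq: "Dia \<xi> \<phi> = Neg (Box \<xi> (Neg \<phi>))"
      by (simp add: Dia_def)
    have "v (Box \<xi>' (Dia \<xi> \<phi>))" if v\<phi>: "\<not> v (Box \<xi> (Neg \<phi>))"
    proof (cases "\<xi>' \<le> \<zeta>")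
      case True
      with neg_intro have \<xi>: "\<xi> < \<zeta>"
        by auto
      with v\<phi> have 0: "Box \<xi> (Neg \<phi>) \<notin> y0"
        by simp
      have "Box \<xi>' (Dia \<xi> \<phi>) \<in> y \<and> Dia \<xi> \<phi> \<in> y" if y: "y \<in> Y" for y
      proof -
        have "Box \<xi> (Neg \<phi>) \<notin> y"
          using agree[OF \<xi> y Y(2)] 0 by blast
        then show ?thesis
          using mcs_not_box_up[OF Y(1)[OF y] neg_intro] Y(1)[OF y] by (simp add: eq)
      qed
      then show ?thesis
        using True Y(2) by auto
    qed auto
    then show ?case by (simp del: v)
  next
    case (mp \<phi> \<chi>)
    then show ?case by simp
  next
    case (nec \<phi> \<xi>)
    then show ?case
      using mcs_GLP[OF _ nec(1)] mcs_GLP[OF _ GLP.nec[OF nec(1)]] Y y0 by simp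
  qed (simp add: tautology_def)
  let ?x = "{\<phi>. pval v \<phi>}"
  have "mcs ?x"
    using snd by (auto simp: mcs_def)
  then show ?thesis
    by (rule that) auto
qed

subsection \<open>Conservativity of an iterated diamond\<close>

text \<open>Pigeonhole: along an \<open>\<eta>\<close>-chain, each \<open>\<phi>\<close> can violate \<open>[\<eta>]\<phi> \<rightarrow> \<phi>\<close> at most once.\<close>

lemma reflexive_on_chain:
  assumes "mcs x" "Q ((WDia \<eta> ^^ Suc n) WTop) \<psi> \<in> x" "finite F" "card F \<le> n"
  shows "\<exists>y. sees \<eta> x y \<and> \<psi> \<in> y \<and> (\<forall>\<phi>\<in>F. Box \<eta> \<phi> \<in> y \<longrightarrow> \<phi> \<in> y)"
  using assms
proof (induction n arbitrary: x F)
  case 0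
  then obtain y where "sees \<eta> x y" "And \<psi> Top \<in> y"
    using mcs_dia_iff_sees[of x \<eta> "And \<psi> Top"] by (auto simp del: mcs_simps)
  then show ?case
    using 0 by (auto simp: sees_def)
next
  case (Suc n)
  let ?A = "(WDia \<eta> ^^ Suc n) WTop"
  have "Dia \<eta> (And \<psi> (Q ?A \<psi>)) \<in> x"
    using Suc.prems(2) by simp
  then obtain y where y: "sees \<eta> x y" "And \<psi> (Q ?A \<psi>) \<in> y"
    using mcs_dia_iff_sees[OF Suc.prems(1)] by blast
  then have my: "mcs y" "\<psi> \<in> y" "Q ?A \<psi> \<in> y"
    by (auto simp: sees_def)
  show ?case
  proof (cases "\<forall>\<phi>\<in>F. Box \<eta> \<phi> \<in> y \<longrightarrow> \<phi> \<in> y")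
    case True
    then show ?thesis using y my by blast
  next
    case False
    then obtain \<phi> where \<phi>: "\<phi> \<in> F" "Box \<eta> \<phi> \<in> y"
      by blast
    have "card (F - {\<phi>}) \<le> n"
      using Suc.prems \<phi>(1) by (simp add: card_Diff_singleton)
    then obtain z where z: "sees \<eta> y z" "\<psi> \<in> z" "\<forall>\<phi>\<in>F - {\<phi>}. Box \<eta> \<phi> \<in> z \<longrightarrow> \<phi> \<in> z"
      using Suc.IH[OF my(1,3), of "F - {\<phi>}"] Suc.prems(3) by auto
    then have "\<phi> \<in> z"
      using \<phi>(2) by (auto simp: sees_def)
    then show ?thesis
      using z sees_trans[OF Suc.prems(1) y(1)] by blast
  qed
qed

lemma dia_conservative:
  assumes less: "\<gamma> < \<zeta>" and prov: "GLP (Imp (Dia \<zeta> \<psi>) (Dia \<gamma> \<chi>))"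
  obtains \<eta> k where "\<gamma> \<le> \<eta>" "\<eta> < \<zeta>" "GLP (Imp (Q ((WDia \<eta> ^^ k) WTop) \<psi>) (Dia \<gamma> \<chi>))"
proof (rule ccontr)
  note elim = that
  assume "\<not> thesis"
  then have no: "\<not> GLP (Imp (Q ((WDia \<eta> ^^ k) WTop) \<psi>) (Dia \<gamma> \<chi>))" if "\<gamma> \<le> \<eta>" "\<eta> < \<zeta>" for \<eta> k
    using that elim by blast
  \<comment> \<open>Membership of \<psi> makes \<open>Dia \<zeta> \<psi>\<close> true at the new
    point, the box refutes \<open>Dia \<gamma> \<chi>\<close> there, and the implications are the
    reflexivity that \<open>mcs_extension\<close> asks for.\<close>
  let ?S = "{\<psi>, Box \<gamma> (Neg \<chi>)} \<union> {Imp (Box \<xi> \<phi>) \<phi> | \<xi> \<phi>. \<xi> < \<zeta>}"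
  have "\<not> entails ?S Bot"
  proof
    assume "entails ?S Bot"
    then obtain l where l: "set l \<subseteq> ?S" "GLP (Imp (Conj l) Bot)"
      by (auto simp: entails_def)
    define P where "P = {(\<xi>, \<phi>). \<xi> < \<zeta> \<and> Imp (Box \<xi> \<phi>) \<phi> \<in> set l}"
    have "(\<lambda>(\<xi>, \<phi>). Imp (Box \<xi> \<phi>) \<phi>) ` P \<subseteq> set l"
      by (auto simp: P_def)
    moreover have "inj_on (\<lambda>(\<xi>, \<phi>). Imp (Box \<xi> \<phi>) \<phi>) P"
      by (auto simp: inj_on_def)
    ultimately have fin: "finite P"
      using finite_imageD finite_subset List.finite_set by blast
    \<comment> \<open>The largest index in the finite inconsistent part. Inserting \<gamma> covers
      empty \<open>P\<close> and ensures \<gamma> \<le> \<eta>, so that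
      \<open>Box \<gamma> (Neg \<chi>)\<close> passes to \<eta>-successors.\<close>
    define \<eta> where "\<eta> = Max (insert \<gamma> (fst ` P))"
    have \<eta>: "\<gamma> \<le> \<eta>" "\<eta> < \<zeta>"
      using fin less by (auto simp: \<eta>_def P_def)
    have \<eta>_ge: "\<xi> \<le> \<eta>" if "(\<xi>, \<phi>) \<in> P" for \<xi> \<phi>
      using that fin unfolding \<eta>_def by (intro Max_ge) force+
    \<comment> \<open>The chain has one step more than there are formulas to be respected.\<close>
    obtain x where x: "mcs x" "Q ((WDia \<eta> ^^ Suc (card (snd ` P))) WTop) \<psi> \<in> x" "Dia \<gamma> \<chi> \<notin> x"
      using no[OF \<eta>] GLP_iff_mcs mcs_simps(2) by blast
    then obtain y where y: "sees \<eta> x y" "\<psi> \<in> y" "\<And>\<phi>. \<phi> \<in> snd ` P \<Longrightarrow> Box \<eta> \<phi> \<in> y \<Longrightarrow> \<phi> \<in> y"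
      using reflexive_on_chain[OF x(1,2), of "snd ` P"] fin by blast
    then have my: "mcs y"
      by (simp add: sees_def)
    have "Box \<gamma> (Neg \<chi>) \<in> x"
      using x by auto
    then have "Box \<eta> (Box \<gamma> (Neg \<chi>)) \<in> x"
      using mcs_four mcs_box_up x(1) \<eta>(1) by blast
    then have "Box \<gamma> (Neg \<chi>) \<in> y"
      using y(1) by (simp add: sees_def)
    \<comment> \<open>A box with a smaller index lifts to \<eta>, so reflexivity at the single index
      \<eta> suffices.\<close>
    moreover have "Imp (Box \<xi> \<phi>) \<phi> \<in> y" if "(\<xi>, \<phi>) \<in> P" for \<xi> \<phi>
      using mcs_box_up[OF my \<eta>_ge[OF that], of \<phi>] y(3)[of \<phi>] that my by force
    ultimately have "set l \<subseteq> y"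
      using l(1) y(2) unfolding P_def by blast
    then show False
      using mcs_mp[OF my l(2)] my by simp
  qed
  then obtain y where my: "mcs y" and y: "?S \<subseteq> y"
    by (rule Lindenbaum)
  have refl: "\<phi> \<in> y" if "\<xi> < \<zeta>" "Box \<xi> \<phi> \<in> y" for \<xi> \<phi>
  proof -
    have "Imp (Box \<xi> \<phi>) \<phi> \<in> y"
      using y that(1) by blast
    with my that(2) show ?thesis by simp
  qed
  obtain x where x: "mcs x" "\<And>\<xi> \<phi>. \<xi> < \<zeta> \<Longrightarrow> Box \<xi> \<phi> \<in> x \<longleftrightarrow> Box \<xi> \<phi> \<in> y"
    "\<And>\<phi>. Box \<zeta> \<phi> \<in> x \<longleftrightarrow> \<phi> \<in> y \<and> Box \<zeta> \<phi> \<in> y"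
    by (rule mcs_extension[of "{y}" y \<zeta>]) (auto intro: my refl)
  have "Dia \<zeta> \<psi> \<in> x"
    using x(1,3) y my by simp
  then have "Dia \<gamma> \<chi> \<in> x"
    using mcs_mp[OF x(1) prov] by blast
  then show False
    using x(1) x(2)[OF less] y by simp
qed

subsection \<open>Consistency of iterated diamonds\<close>

text \<open>Generic sets see as much as possible, so the extension point over all of them is generic again
  and the extension can be iterated.\<close>

function generic :: "'l::wellorder \<Rightarrow> 'l fm set set" where
  "generic \<zeta> = {y. mcs y \<and> (\<forall>\<xi>\<in>{..<\<zeta>}. \<forall>\<phi>. Box \<xi> \<phi> \<in> y \<longleftrightarrow> (\<forall>z\<in>generic \<xi>. \<phi> \<in> z))}"
  by auto
termination
  by (relation "{(x, y). x < y}") (auto simp: wf)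

declare generic.simps [simp del]

lemma generic_iff:
  "y \<in> generic \<zeta> \<longleftrightarrow> mcs y \<and> (\<forall>\<xi><\<zeta>. \<forall>\<phi>. Box \<xi> \<phi> \<in> y \<longleftrightarrow> (\<forall>z\<in>generic \<xi>. \<phi> \<in> z))"
  by (subst generic.simps) auto

lemma generic_mcs: "y \<in> generic \<zeta> \<Longrightarrow> mcs y"
  by (simp add: generic.simps[of \<zeta>])

lemma generic_step:
  assumes "y0 \<in> generic \<zeta>"
  obtains x where "x \<in> generic \<zeta>" "\<And>\<phi>. Box \<zeta> \<phi> \<in> x \<longleftrightarrow> (\<forall>y\<in>generic \<zeta>. \<phi> \<in> y)"
proof -
  have down: "y \<in> generic \<xi>" if "\<xi> < \<zeta>" "y \<in> generic \<zeta>" for \<xi> y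
    using that generic_iff[of y \<zeta>] generic_iff[of y \<xi>] by auto
  obtain x where x: "mcs x" "\<And>\<xi> \<phi>. \<xi> < \<zeta> \<Longrightarrow> Box \<xi> \<phi> \<in> x \<longleftrightarrow> Box \<xi> \<phi> \<in> y0"
    "\<And>\<phi>. Box \<zeta> \<phi> \<in> x \<longleftrightarrow> (\<forall>y\<in>generic \<zeta>. \<phi> \<in> y \<and> Box \<zeta> \<phi> \<in> y)"
  proof (rule mcs_extension[of "generic \<zeta>" y0 \<zeta>])
    \<comment> \<open>By \<open>down\<close>, \<open>y\<close> is itself one of the sets in
      \<open>generic \<xi>\<close> over which its \<xi>-boxes quantify.\<close>
    show "\<phi> \<in> y" if "\<xi> < \<zeta>" "y \<in> generic \<zeta>" "Box \<xi> \<phi> \<in> y" for \<xi> \<phi> y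
      using that(2,3) down[OF that(1,2)] generic_iff[of y \<zeta>] that(1) by blast
    show "Box \<xi> \<phi> \<in> y'" if "\<xi> < \<zeta>" "y \<in> generic \<zeta>" "y' \<in> generic \<zeta>" "Box \<xi> \<phi> \<in> y" for \<xi> \<phi> y y'
      using that generic_iff[of y \<zeta>] generic_iff[of y' \<zeta>] by blast
  qed (use assms in \<open>auto intro: generic_mcs\<close>)
  \<comment> \<open>This absorbs the second conjunct in the description of the \<zeta>-boxes of
    \<open>x\<close>: \<open>generic \<zeta>\<close> is closed under \<zeta>-successors, since these
    keep all lower boxes.\<close>
  have "Box \<zeta> \<phi> \<in> y" if all: "\<forall>y\<in>generic \<zeta>. \<phi> \<in> y" and y: "y \<in> generic \<zeta>" for \<phi> y
  proof -
    have my: "mcs y"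
      using y by (rule generic_mcs)
    have "z \<in> generic \<zeta>" if z: "sees \<zeta> y z" for z
    proof -
      have "Box \<xi> \<theta> \<in> z \<longleftrightarrow> Box \<xi> \<theta> \<in> y" if "\<xi> < \<zeta>" for \<xi> \<theta>
        by (rule sees_box_iff[OF my z that])
      with y z show ?thesis
        unfolding generic_iff[of _ \<zeta>] by (simp add: sees_def)
    qed
    then show ?thesis
      using mcs_box_iff_sees[OF my] all by blast
  qed
  moreover have "x \<in> generic \<zeta>"
    using x(1,2) assms unfolding generic_iff[of _ \<zeta>] by simp
  ultimately show ?thesis
    using that x(3) by blast
qed

text \<open>Making every box true models a point without successors.\<close>

lemma GLP_consistent: "\<not> GLP Bot"
proof -
  have "pval (\<lambda>_. True) \<phi>" if "GLP \<phi>" for \<phi> :: "'l::wellorder fm"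
    using that by (induction rule: GLP.induct) (simp_all add: tautology_def)
  then show ?thesis
    by fastforce
qed

text \<open>By compactness only finitely many requirements on lower boxes matter at once. If \<xi>
  is their largest index, the point that \<open>generic_step\<close> yields at \<xi> decides all
  boxes up to \<xi> as required.\<close>

lemma generic_nonempty: "generic \<zeta> \<noteq> {}"
proof (induction \<zeta> rule: less_induct)
  case (less \<zeta>)
  define all where "all \<xi> \<phi> \<longleftrightarrow> (\<forall>z\<in>generic \<xi>. \<phi> \<in> z)" for \<xi> :: 'a and \<phi>
  let ?S = "{Box \<xi> \<phi> | \<xi> \<phi>. \<xi> < \<zeta> \<and> all \<xi> \<phi>} \<union> {Neg (Box \<xi> \<phi>) | \<xi> \<phi>. \<xi> < \<zeta> \<and> \<not> all \<xi> \<phi>}"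
  have "\<not> entails ?S Bot"
  proof
    assume "entails ?S Bot"
    then obtain l where l: "set l \<subseteq> ?S" "GLP (Imp (Conj l) Bot)"
      by (auto simp: entails_def)
    \<comment> \<open>Reads off the index of either kind of requirement; \<open>Neg\<close> unfolds
      to an implication, hence the \<open>Imp\<close> pattern.\<close>
    obtain m :: "'a fm \<Rightarrow> 'a" where m: "\<And>\<xi> \<phi>. m (Box \<xi> \<phi>) = \<xi>" "\<And>\<xi> \<phi>. m (Neg (Box \<xi> \<phi>)) = \<xi>"
    proof
      show "(\<lambda>\<theta>. case \<theta> of Box \<xi> _ \<Rightarrow> \<xi> | Imp (Box \<xi> _) _ \<Rightarrow> \<xi>) (Box \<xi> \<phi>) = \<xi>"
        "(\<lambda>\<theta>. case \<theta> of Box \<xi> _ \<Rightarrow> \<xi> | Imp (Box \<xi> _) _ \<Rightarrow> \<xi>) (Neg (Box \<xi> \<phi>)) = \<xi>" for \<xi> :: 'a and \<phi>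
        by (simp_all add: Neg_def)
    qed
    have "l \<noteq> []"
    proof
      assume "l = []"
      have "GLP (Bot :: 'a fm)"
        by (rule GLP_taut1[OF l(2)]) (simp add: \<open>l = []\<close>)
      then show False
        using GLP_consistent by blast
    qed
    define \<xi>\<^sub>0 where "\<xi>\<^sub>0 = Max (m ` set l)"
    have "\<xi>\<^sub>0 \<in> m ` set l"
      using \<open>l \<noteq> []\<close> by (simp add: \<xi>\<^sub>0_def)
    then have "\<xi>\<^sub>0 < \<zeta>"
      using l(1) m by auto
    then obtain x where x: "x \<in> generic \<xi>\<^sub>0" "\<And>\<phi>. Box \<xi>\<^sub>0 \<phi> \<in> x \<longleftrightarrow> all \<xi>\<^sub>0 \<phi>"
      using less.IH generic_step unfolding all_def by (metis all_not_in_conv)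
    have mx: "mcs x"
      using x(1) by (rule generic_mcs)
    have box: "Box \<xi> \<phi> \<in> x \<longleftrightarrow> all \<xi> \<phi>" if "\<xi> \<le> \<xi>\<^sub>0" for \<xi> \<phi>
      using that x generic_iff[of x \<xi>\<^sub>0] unfolding all_def by (cases "\<xi> = \<xi>\<^sub>0") auto
    have "\<theta> \<in> x" if \<theta>: "\<theta> \<in> set l" for \<theta>
    proof -
      have "m \<theta> \<le> \<xi>\<^sub>0"
        using \<theta> by (simp add: \<xi>\<^sub>0_def)
      moreover have "\<theta> \<in> ?S"
        using \<theta> l(1) by blast
      ultimately show ?thesis
        using box m mx by auto
    qed
    then have "Conj l \<in> x"
      using mx by auto
    then show False
      using mcs_mp[OF mx l(2)] mx by simp
  qed
  then obtain y where my: "mcs y" and y: "?S \<subseteq> y"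
    by (rule Lindenbaum)
  have "Box \<xi> \<phi> \<in> y \<longleftrightarrow> all \<xi> \<phi>" if "\<xi> < \<zeta>" for \<xi> \<phi>
  proof (cases "all \<xi> \<phi>")
    case True
    with that y show ?thesis by blast
  next
    case False
    with that have "Neg (Box \<xi> \<phi>) \<in> ?S" by blast
    with y have "Neg (Box \<xi> \<phi>) \<in> y" by blast
    with False my show ?thesis by simp
  qed
  with my have "y \<in> generic \<zeta>"
    unfolding generic_iff[of _ \<zeta>] all_def by simp
  then show ?case by blast
qed

text \<open>Each use of \<open>generic_step\<close> adds one diamond: the new point sees every
  generic set, including one that contains the shorter worm.\<close>

lemma power_worm_generic: "\<exists>x\<in>generic \<zeta>. fm_of ((WDia \<zeta> ^^ k) WTop) \<in> x"
proof (induction k)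
  case 0
  obtain x where "x \<in> generic \<zeta>"
    using generic_nonempty by blast
  then show ?case
    by (intro bexI[of _ x]) (simp_all add: generic_mcs)
next
  case (Suc k)
  let ?\<phi> = "fm_of ((WDia \<zeta> ^^ k) WTop)"
  obtain y where y: "y \<in> generic \<zeta>" "?\<phi> \<in> y"
    using Suc by blast
  obtain x where x: "x \<in> generic \<zeta>" "\<And>\<phi>. Box \<zeta> \<phi> \<in> x \<longleftrightarrow> (\<forall>y\<in>generic \<zeta>. \<phi> \<in> y)"
    using generic_step[OF y(1)] by blast
  have "mcs x" "mcs y"
    using x(1) y(1) by (auto intro: generic_mcs)
  with x y have "Dia \<zeta> ?\<phi> \<in> x"
    by (metis mcs_simps(3,6))
  with x(1) show ?case
    by auto
qed

text \<open>By Loeb's axiom, a formula implying its own \<xi>-possibility is refutable, but these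
  worms hold at some generic set.\<close>

lemma power_worm_irrefl: "\<not> worm_less \<xi> ((WDia \<eta> ^^ k) WTop) ((WDia \<eta> ^^ k) WTop)"
proof
  let ?\<phi> = "fm_of ((WDia \<eta> ^^ k) WTop)"
  assume "worm_less \<xi> ((WDia \<eta> ^^ k) WTop) ((WDia \<eta> ^^ k) WTop)"
  then have *: "GLP (Imp (Box \<xi> (Neg ?\<phi>)) (Neg ?\<phi>))"
    unfolding worm_less_def by (rule GLP_taut1) auto
  then have "GLP (Box \<xi> (Neg ?\<phi>))"
    using GLP.nec GLP.loeb GLP.mp by blast
  with * have "GLP (Neg ?\<phi>)"
    using GLP.mp by blast
  moreover obtain x where "x \<in> generic \<eta>" "?\<phi> \<in> x"
    using power_worm_generic by blast
  ultimately show False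
    using mcs_GLP[OF generic_mcs] mcs_simps(3)[OF generic_mcs] by blast
qed

subsection \<open>Worms relativized to a formula\<close>

text \<open>Take a \<zeta>-successor satisfying \<psi>. The formula \<open>Q B \<psi>\<close> is
  \<open>Top\<close> or starts with a diamond below \<zeta>, so its truth transfers to that
  successor; monotonicity then lowers the outer \<zeta> to \<xi>.\<close>

lemma dia_imp_Q:
  assumes "\<forall>\<xi>\<in>modalities B. \<xi> < \<zeta>"
  shows "GLP (Imp (Dia \<zeta> \<psi>) (Q B \<psi>))"
  using assms
proof (induction B)
  case WTop
  show ?case by (auto intro: GLP_tautI)
next
  case (WDia \<xi> B)
  have "Q (WDia \<xi> B) \<psi> \<in> x" if mx: "mcs x" and x: "Dia \<zeta> \<psi> \<in> x" for x
  proof -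
    have "Q B \<psi> \<in> x"
      using WDia mcs_mp[OF mx _ x] by auto
    obtain y where y: "sees \<zeta> x y" "\<psi> \<in> y"
      using mcs_dia_iff_sees[OF mx] x by blast
    then have my: "mcs y"
      by (simp add: sees_def)
    have "Q B \<psi> \<in> y"
    proof (cases B)
      case WTop
      then show ?thesis using my by simp
    next
      case (WDia \<xi>' C)
      have "\<xi>' < \<zeta>"
        using WDia WDia.prems by simp
      with sees_box_iff[OF mx y(1)] \<open>Q B \<psi> \<in> x\<close> my mx WDia show ?thesis by simp
    qed
    then have "And \<psi> (Q B \<psi>) \<in> y"
      using y(2) my by simp
    then have "Dia \<zeta> (And \<psi> (Q B \<psi>)) \<in> x"
      using mcs_dia_iff_sees[OF mx] y(1) by blast
    then show ?thesis
      using mcs_mp[OF mx GLP.mono[of \<xi> \<zeta>]] WDia.prems by simp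
  qed
  then show ?case
    using GLP_iff_mcs mcs_simps(2) by blast
qed

lemma GLP_Q_Top: "GLP (Imp (Q B Top) (fm_of B))"
proof (induction B)
  case (WDia \<xi> B)
  have "GLP (Imp (And Top (Q B Top)) (fm_of B))"
    by (rule GLP_taut1[OF WDia]) auto
  then show ?case
    using GLP_dia_mono by simp
qed (auto intro: GLP_tautI)

lemma dia_imp_worm:
  assumes "\<forall>\<xi>\<in>modalities B. \<xi> < \<zeta>"
  shows "GLP (Imp (Dia \<zeta> Top) (fm_of B))"
  using GLP_trans[OF dia_imp_Q[OF assms] GLP_Q_Top] .

lemma GLP_And_mono: "GLP (Imp \<phi> \<chi>) \<Longrightarrow> GLP (Imp (And \<psi> \<phi>) (And \<psi> \<chi>))"
  by (rule GLP_taut1) auto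

text \<open>Truncation replaces a subformula in a positive position by \<open>Top\<close>.\<close>

lemma GLP_Q_head: "GLP (Imp (Q A \<psi>) (Q (head \<gamma> A) \<psi>))"
proof (induction A)
  case (WDia \<xi> A)
  then show ?case
    using GLP_dia_mono[OF GLP_And_mono] by (auto intro: GLP_tautI)
qed (auto intro: GLP_tautI)

lemma modalities_head: "\<xi> \<in> modalities (head \<gamma> A) \<Longrightarrow> \<gamma> \<le> \<xi> \<and> \<xi> \<in> modalities A"
  by (induction A) (auto split: if_splits)

text \<open>Box modalities from \<open>b\<close> on are erased, since \<open>h\<close> need not be monotone there.\<close>

primrec relativize :: "('l \<Rightarrow> 'l) \<Rightarrow> 'l \<Rightarrow> 'l fm \<Rightarrow> 'l::wellorder fm \<Rightarrow> 'l fm" where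
  "relativize h b \<psi> (Var n) = Var n"
| "relativize h b \<psi> Bot = Bot"
| "relativize h b \<psi> (Imp \<phi> \<chi>) = Imp (relativize h b \<psi> \<phi>) (relativize h b \<psi> \<chi>)"
| "relativize h b \<psi> (Box \<xi> \<phi>) = (if \<xi> < b then Box (h \<xi>) (Imp \<psi> (relativize h b \<psi> \<phi>)) else Top)"

lemma relativize_Neg [simp]:
  "relativize h b \<psi> (Neg \<phi>) = Neg (relativize h b \<psi> \<phi>)"
  "relativize h b \<psi> (Dia \<xi> \<phi>) = Neg (relativize h b \<psi> (Box \<xi> (Neg \<phi>)))"
  "relativize h b \<psi> Top = Top"
  by (simp_all add: Neg_def Dia_def Top_def)

text \<open>Relativization commutes with the propositional connectives, so it sends tautologies to
  tautologies.\<close>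

lemma pval_relativize: "pval v (relativize h b \<psi> \<phi>) = pval (\<lambda>\<theta>. pval v (relativize h b \<psi> \<theta>)) \<phi>"
  by (induction \<phi>) simp_all

text \<open>Each axiom survives reading a box as quantifying over successors that satisfy \<psi>.
  Strict monotonicity of \<open>h\<close> preserves the two axioms mixing modalities; instances with
  an erased box become propositionally trivial.\<close>

lemma GLP_relativize:
  assumes "GLP \<phi>" and h: "\<And>\<xi> \<xi>'. \<xi> < \<xi>' \<Longrightarrow> \<xi>' < b \<Longrightarrow> h \<xi> < h \<xi>'"
  shows "GLP (relativize h b \<psi> \<phi>)"
  using assms(1)
proof (induction rule: GLP.induct)
  case (taut \<phi>)
  then show ?case
    by (intro GLP_tautI) (simp add: pval_relativize[of _ _ _ _ \<phi>] tautology_def del: pval_simps)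
next
  case (dist \<xi> \<phi> \<chi>)
  let ?\<phi> = "relativize h b \<psi> \<phi>" and ?\<chi> = "relativize h b \<psi> \<chi>"
  have "GLP (Imp (Imp \<psi> (Imp ?\<phi> ?\<chi>)) (Imp (Imp \<psi> ?\<phi>) (Imp \<psi> ?\<chi>)))"
    by (auto intro: GLP_tautI)
  from mcs_box_mono2[OF _ this] show ?case
    by (auto simp: GLP_iff_mcs)
next
  case (four \<xi> \<phi>)
  let ?\<phi> = "Box (h \<xi>) (Imp \<psi> (relativize h b \<psi> \<phi>))"
  have "GLP (Imp ?\<phi> (Imp \<psi> ?\<phi>))"
    by (auto intro: GLP_tautI)
  from GLP_trans[OF GLP.four GLP_box_mono[OF this]] show ?case
    by (auto intro: GLP_tautI)
next
  \<comment> \<open>Loeb's axiom is applied to \<open>Imp \<psi> \<phi>\<close>, with \<phi>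
    relativized, after exchanging the two premises under the box.\<close>
  case (loeb \<xi> \<phi>)
  let ?\<phi> = "relativize h b \<psi> \<phi>"
  let ?\<beta> = "Box (h \<xi>) (Imp \<psi> ?\<phi>)"
  have "GLP (Imp (Imp \<psi> (Imp ?\<beta> ?\<phi>)) (Imp ?\<beta> (Imp \<psi> ?\<phi>)))"
    by (auto intro: GLP_tautI)
  from GLP_trans[OF GLP_box_mono[OF this] GLP.loeb] show ?case
    by (auto intro: GLP_tautI)
next
  case (mono \<xi> \<zeta> \<phi>)
  let ?\<theta> = "Imp \<psi> (Neg (relativize h b \<psi> \<phi>))"
  have "GLP (Imp (Box (h \<xi>) ?\<theta>) (Box (h \<zeta>) ?\<theta>))" if "\<zeta> < b"
    using mcs_box_up[OF _ less_imp_le[OF h[OF mono that]]] by (auto simp: GLP_iff_mcs)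
  then have "\<zeta> < b \<Longrightarrow> GLP (Imp (Neg (Box (h \<zeta>) ?\<theta>)) (Neg (Box (h \<xi>) ?\<theta>)))"
    by (rule GLP_contrapos)
  with mono show ?case
    by (auto intro: GLP_tautI)
next
  case (neg_intro \<xi> \<zeta> \<phi>)
  let ?\<beta> = "Box (h \<xi>) (Imp \<psi> (Neg (relativize h b \<psi> \<phi>)))"
  have imp: "GLP (Imp (Neg ?\<beta>) (Imp \<psi> (Neg ?\<beta>)))"
    by (auto intro: GLP_tautI)
  have "GLP (Imp (Neg ?\<beta>) (Box (h \<zeta>) (Imp \<psi> (Neg ?\<beta>))))" if "\<zeta> < b"
    using mcs_not_box_up[OF _ h[OF neg_intro that]] mcs_box_mono[OF _ imp]
    by (auto simp: GLP_iff_mcs)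
  with neg_intro show ?case
    by (auto intro: GLP_tautI)
next
  case (mp \<phi> \<chi>)
  then show ?case
    using GLP.mp by simp
next
  case (nec \<phi> \<xi>)
  have "GLP (Imp \<psi> (relativize h b \<psi> \<phi>))"
    by (rule GLP_taut1[OF nec.IH]) auto
  then show ?case
    by (auto intro: GLP.nec GLP_tautI)
qed

text \<open>Relativization undoes the renaming \<open>g\<close>, and the guard \<psi> on boxes
  becomes, dually, the conjunct \<psi> that \<open>Q\<close> inserts under diamonds.\<close>

lemma relativize_worm:
  assumes "\<And>\<xi>. \<xi> \<in> modalities B \<Longrightarrow> g \<xi> < b \<and> h (g \<xi>) = \<xi>"
  shows "GLP (Imp (relativize h b \<psi> (fm_of (map_worm g B))) (Q B \<psi>)) \<and>
    GLP (Imp (Q B \<psi>) (relativize h b \<psi> (fm_of (map_worm g B))))"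
  using assms
proof (induction B)
  case (WDia \<xi> B)
  let ?R = "relativize h b \<psi> (fm_of (map_worm g B))"
  have IH: "GLP (Imp ?R (Q B \<psi>))" "GLP (Imp (Q B \<psi>) ?R)"
    using WDia by auto
  have "GLP (Imp (Imp \<psi> (Neg ?R)) (Neg (And \<psi> (Q B \<psi>))))" "GLP (Imp (Neg (And \<psi> (Q B \<psi>))) (Imp \<psi> (Neg ?R)))"
    by (rule GLP_taut1[OF IH(2)]; auto) (rule GLP_taut1[OF IH(1)]; auto)
  then have "GLP (Imp (Neg (Box \<xi> (Imp \<psi> (Neg ?R)))) (Neg (Box \<xi> (Neg (And \<psi> (Q B \<psi>))))))"
    "GLP (Imp (Neg (Box \<xi> (Neg (And \<psi> (Q B \<psi>))))) (Neg (Box \<xi> (Imp \<psi> (Neg ?R)))))"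
    by (auto intro: GLP_contrapos GLP_box_mono)
  moreover have "g \<xi> < b" "h (g \<xi>) = \<xi>"
    using WDia.prems by simp_all
  ultimately show ?case
    by (simp add: Dia_def[of \<xi>])
qed (auto intro: GLP_tautI)

subsection \<open>Left subtraction of ordinals\<close>

lemma below_iff: "(a, b) \<in> below \<xi> \<longleftrightarrow> a \<le> b \<and> b < \<xi>"
  by (simp add: below_def)

lemma Field_below: "Field (below \<xi>) = {..<\<xi>}"
  by (auto simp: below_def Field_def)

lemma Well_order_below: "Well_order (below (\<xi> :: 'l::wellorder))"
proof -
  have "wf (below \<xi> - Id)"
    by (rule wf_subset[OF wf]) (auto simp: below_def)
  then show ?thesis
    unfolding well_order_on_def linear_order_on_def partial_order_on_def preorder_on_def Field_below
    by (auto simp: below_def refl_on_def trans_def antisym_def total_on_def)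
qed

lemma ord_sum_below_iff [simp]:
  "(Inl a, Inl a') \<in> ord_sum (below \<gamma>) (below \<delta>) \<longleftrightarrow> a \<le> a' \<and> a' < \<gamma>"
  "(Inr d, Inr d') \<in> ord_sum (below \<gamma>) (below \<delta>) \<longleftrightarrow> d \<le> d' \<and> d' < \<delta>"
  "(Inl a, Inr d) \<in> ord_sum (below \<gamma>) (below \<delta>) \<longleftrightarrow> a < \<gamma> \<and> d < \<delta>"
  "(Inr d, Inl a) \<notin> ord_sum (below \<gamma>) (below \<delta>)"
  by (simp_all add: ord_sum_def Field_below) (auto simp: below_def)

lemma Field_ord_sum: "Field (ord_sum (below \<gamma>) (below \<delta>)) = Inl ` {..<\<gamma>} \<union> Inr ` {..<\<delta>}"
proof (rule set_eqI)
  fix p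
  have "(p, q) \<in> ord_sum (below \<gamma>) (below \<delta>) \<or> (q, p) \<in> ord_sum (below \<gamma>) (below \<delta>)
      \<Longrightarrow> p \<in> Inl ` {..<\<gamma>} \<union> Inr ` {..<\<delta>}" for q
    by (cases p; cases q) (auto intro: le_less_trans)
  moreover have "p \<in> Inl ` {..<\<gamma>} \<union> Inr ` {..<\<delta>} \<Longrightarrow> (p, p) \<in> ord_sum (below \<gamma>) (below \<delta>)"
    by auto
  ultimately show "p \<in> Field (ord_sum (below \<gamma>) (below \<delta>)) \<longleftrightarrow> p \<in> Inl ` {..<\<gamma>} \<union> Inr ` {..<\<delta>}"
    unfolding Field_def by blast
qed

text \<open>The smaller sum is the initial segment of the larger one strictly below
  \<open>Inr \<delta>\<close>. This yields uniqueness of left differences.\<close>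

lemma ord_sum_below_less:
  assumes "\<delta> < \<delta>'" "Well_order (ord_sum (below \<gamma>) (below \<delta>'))"
  shows "ord_sum (below \<gamma>) (below \<delta>) <o ord_sum (below \<gamma>) (below \<delta>')"
proof -
  let ?r = "ord_sum (below \<gamma>) (below \<delta>')" and ?s = "ord_sum (below \<gamma>) (below \<delta>)"
  have under: "p \<in> underS ?r (Inr \<delta>) \<longleftrightarrow> p \<in> Field ?s" for p
    using assms(1) by (cases p) (auto simp: underS_def Field_ord_sum)
  have "(p, q) \<in> Restr ?r (underS ?r (Inr \<delta>)) \<longleftrightarrow> (p, q) \<in> ?s" for p q
    using assms(1) by (cases p; cases q) (auto simp: under Field_ord_sum)
  then have "Restr ?r (underS ?r (Inr \<delta>)) = ?s"
    by auto
  moreover have "Field ?r \<noteq> {}"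
    using assms(1) by (auto simp: Field_ord_sum)
  ultimately show ?thesis
    using underS_Restr_ordLess[OF assms(2)] by metis
qed

text \<open>The collapse of the interval from \<gamma> up to \<xi> onto an initial segment of
  \<open>'l\<close>: it computes the left difference by recursion instead of by order types.\<close>

function rank_from :: "'l::wellorder \<Rightarrow> 'l \<Rightarrow> 'l" where
  "rank_from \<gamma> \<xi> = (LEAST \<delta>. \<forall>\<xi>'\<in>{\<gamma>..<\<xi>}. rank_from \<gamma> \<xi>' < \<delta>)"
  by auto
termination
  by (relation "inv_image {(x, y). x < y} snd") (auto simp: wf)

declare rank_from.simps [simp del]

lemma rank_from_le: "rank_from \<gamma> \<xi> \<le> \<xi>"
proof (induction \<xi> rule: less_induct)
  case (less \<xi>)
  then have "\<forall>\<xi>'\<in>{\<gamma>..<\<xi>}. rank_from \<gamma> \<xi>' < \<xi>"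
    by (meson atLeastLessThan_iff le_less_trans)
  then show ?case
    by (subst rank_from.simps) (rule Least_le)
qed

lemma rank_from_mono:
  assumes "\<gamma> \<le> \<xi>'" "\<xi>' < \<xi>"
  shows "rank_from \<gamma> \<xi>' < rank_from \<gamma> \<xi>"
proof -
  have "\<forall>\<xi>'\<in>{\<gamma>..<\<xi>}. rank_from \<gamma> \<xi>' < \<xi>"
    by (meson atLeastLessThan_iff le_less_trans rank_from_le)
  then have "\<forall>\<xi>'\<in>{\<gamma>..<\<xi>}. rank_from \<gamma> \<xi>' < rank_from \<gamma> \<xi>"
    unfolding rank_from.simps[of \<gamma> \<xi>] by (rule LeastI)
  with assms show ?thesis by simp
qed

text \<open>A value below the least strict bound is no strict bound itself, so some earlier rank
  reaches it or exceeds it; in the latter case descend.\<close>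

lemma rank_from_onto:
  "\<delta> < rank_from \<gamma> \<xi> \<Longrightarrow> \<exists>\<xi>'. \<gamma> \<le> \<xi>' \<and> \<xi>' < \<xi> \<and> rank_from \<gamma> \<xi>' = \<delta>"
proof (induction \<xi> rule: less_induct)
  case (less \<xi>)
  have "\<not> (\<forall>\<xi>'\<in>{\<gamma>..<\<xi>}. rank_from \<gamma> \<xi>' < \<delta>)"
    using less.prems by (subst (asm) rank_from.simps) (rule not_less_Least)
  then obtain \<xi>' where \<xi>': "\<gamma> \<le> \<xi>'" "\<xi>' < \<xi>" "\<delta> \<le> rank_from \<gamma> \<xi>'"
    by (auto simp: not_less)
  show ?case
  proof (cases "\<delta> = rank_from \<gamma> \<xi>'")
    case False
    with \<xi>'(3) have "\<delta> < rank_from \<gamma> \<xi>'"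
      by simp
    then obtain \<xi>'' where "\<gamma> \<le> \<xi>''" "\<xi>'' < \<xi>'" "rank_from \<gamma> \<xi>'' = \<delta>"
      using less.IH[OF \<xi>'(2)] by blast
    with \<xi>'(2) show ?thesis
      using less_trans by blast
  qed (use \<xi>' in blast)
qed

lemma left_minus_eq:
  assumes "\<gamma> \<le> \<xi>"
  shows "left_minus \<gamma> \<xi> = rank_from \<gamma> \<xi>"
proof -
  \<comment> \<open>The isomorphism from the predecessors of \<xi> onto the sum: the part below
    \<gamma> is kept, the rest is collapsed.\<close>
  define k where "k \<eta> = (if \<eta> < \<gamma> then Inl \<eta> else Inr (rank_from \<gamma> \<eta>))" for \<eta>
  have rank_iff: "rank_from \<gamma> a < rank_from \<gamma> b \<longleftrightarrow> a < b" if "\<gamma> \<le> a" "\<gamma> \<le> b" for a b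
    using rank_from_mono[of \<gamma> a b] rank_from_mono[of \<gamma> b a] that by (metis less_irrefl less_trans neq_iff)
  have rank_le_iff: "rank_from \<gamma> a \<le> rank_from \<gamma> b \<longleftrightarrow> a \<le> b" if "\<gamma> \<le> a" "\<gamma> \<le> b" for a b
    using rank_iff[OF that(2,1)] by (simp flip: not_less)
  have k_iff: "(k a, k b) \<in> ord_sum (below \<gamma>) (below (rank_from \<gamma> \<xi>)) \<longleftrightarrow> (a, b) \<in> below \<xi>" for a b
    using assms rank_iff[of b \<xi>] rank_le_iff[of a b] unfolding below_iff by (auto simp: k_def)
  have k_onto: "\<exists>a. p = k a" if p: "p \<in> Field (ord_sum (below \<gamma>) (below (rank_from \<gamma> \<xi>)))" for p
  proof (cases p)
    case (Inl a)
    with p show ?thesis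
      by (intro exI[of _ a]) (auto simp: Field_ord_sum k_def)
  next
    case (Inr d)
    then obtain a where "\<gamma> \<le> a" "rank_from \<gamma> a = d"
      using p rank_from_onto[of d \<gamma> \<xi>] by (auto simp: Field_ord_sum)
    with Inr show ?thesis
      by (intro exI[of _ a]) (auto simp: k_def)
  qed
  have "inj k"
  proof (rule injI)
    fix a b assume "k a = k b"
    then show "a = b"
      using rank_le_iff[of a b] rank_le_iff[of b a] by (auto simp: k_def not_less split: if_splits)
  qed
  then have inj: "inj_on k (Field (below \<xi>))"
    by (rule inj_on_subset) simp
  have "(p, q) \<in> dir_image (below \<xi>) k \<longleftrightarrow> (p, q) \<in> ord_sum (below \<gamma>) (below (rank_from \<gamma> \<xi>))" for p q
  proof
    assume "(p, q) \<in> dir_image (below \<xi>) k"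
    then show "(p, q) \<in> ord_sum (below \<gamma>) (below (rank_from \<gamma> \<xi>))"
      using k_iff by (auto simp: dir_image_def)
  next
    assume pq: "(p, q) \<in> ord_sum (below \<gamma>) (below (rank_from \<gamma> \<xi>))"
    obtain a b where "p = k a" "q = k b"
      using k_onto[OF FieldI1[OF pq]] k_onto[OF FieldI2[OF pq]] by blast
    with pq k_iff show "(p, q) \<in> dir_image (below \<xi>) k"
      by (auto simp: dir_image_def)
  qed
  then have "dir_image (below \<xi>) k = ord_sum (below \<gamma>) (below (rank_from \<gamma> \<xi>))"
    by auto
  then have iso: "ord_sum (below \<gamma>) (below (rank_from \<gamma> \<xi>)) =o below \<xi>"
    using ordIso_symmetric[OF dir_image_ordIso[OF Well_order_below inj]] by simp
  show ?thesis
    unfolding left_minus_def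
  proof (rule the_equality)
    show "ord_sum (below \<gamma>) (below (rank_from \<gamma> \<xi>)) =o below \<xi>"
      by (rule iso)
  next
    fix \<delta> :: 'a assume \<delta>: "ord_sum (below \<gamma>) (below \<delta>) =o below \<xi>"
    have "Well_order (ord_sum (below \<gamma>) (below \<delta>))" "Well_order (ord_sum (below \<gamma>) (below (rank_from \<gamma> \<xi>)))"
      using \<delta> iso by (auto simp: ordIso_def)
    moreover have "ord_sum (below \<gamma>) (below \<delta>) =o ord_sum (below \<gamma>) (below (rank_from \<gamma> \<xi>))"
      by (rule ordIso_transitive[OF \<delta> ordIso_symmetric[OF iso]])
    ultimately show "\<delta> = rank_from \<gamma> \<xi>"
      using ord_sum_below_less[of \<delta> "rank_from \<gamma> \<xi>" \<gamma>] ord_sum_below_less[of "rank_from \<gamma> \<xi>" \<delta> \<gamma>]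
        not_ordLess_ordIso ordIso_symmetric by (cases \<delta> "rank_from \<gamma> \<xi>" rule: linorder_cases) blast+
  qed
qed

lemma rank_from_self: "rank_from \<gamma> \<gamma> = ord_zero"
  unfolding rank_from.simps[of \<gamma> \<gamma>] ord_zero_def by simp

subsection \<open>Cofinality\<close>

lemma GLP_dia_trans: "GLP (Imp (Dia \<xi> (Dia \<xi> \<phi>)) (Dia \<xi> \<phi>))"
proof -
  have "Dia \<xi> \<phi> \<in> x" if mx: "mcs x" and x: "Dia \<xi> (Dia \<xi> \<phi>) \<in> x" for x
  proof -
    obtain y where y: "sees \<xi> x y" "Dia \<xi> \<phi> \<in> y"
      using x mcs_dia_iff_sees[OF mx] by blast
    then have "mcs y"
      by (simp add: sees_def)
    then obtain z where "sees \<xi> y z" "\<phi> \<in> z"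
      using y(2) mcs_dia_iff_sees by blast
    then show ?thesis
      using sees_trans[OF mx y(1)] mcs_dia_iff_sees[OF mx] by blast
  qed
  then show ?thesis
    using GLP_iff_mcs mcs_simps(2) by blast
qed

lemma worm_less_trans: "worm_less \<gamma> A B \<Longrightarrow> worm_less \<gamma> B C \<Longrightarrow> worm_less \<gamma> A C"
  unfolding worm_less_def by (rule GLP_trans[OF _ GLP_trans[OF GLP_dia_mono GLP_dia_trans]])

text \<open>Here \<open>worm_order\<close> is not known to be a well-order, but its part below
  \<open>Z\<close> is, as the supremum is an ordinal. So worms are compared inside that part,
  through their sets of predecessor classes, which are initial segments of it.\<close>

lemma cofinal_above:
  fixes D :: "'l::wellorder worm"
  assumes sup: "is_osup (worm_o ` X) (worm_o Z)"
    and X: "\<And>B. B \<in> X \<Longrightarrow> worm_less ord_zero B Z"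
    and D: "worm_less ord_zero D Z" "\<not> worm_less ord_zero D D"
  obtains B where "B \<in> X" "worm_less ord_zero D B"
proof -
  define P where "P B = worm_class ` {C. worm_less ord_zero C B}" for B :: "'l worm"
  let ?r = "worm_o Z"
  have wo: "Well_order ?r" and lin: "Total ?r"
    using sup by (auto simp: is_osup_def well_order_on_def linear_order_on_def)
  have r: "?r = Restr worm_order (P Z)" and o: "worm_o B = Restr worm_order (P B)" for B :: "'l worm"
    by (simp_all add: worm_o_def P_def)
  have refl: "(worm_class B, worm_class B) \<in> worm_order" for B :: "'l worm"
    using worm_order_iff[of B B] worm_class_eq_iff[of B B] by blast
  have P_iff: "worm_class C \<in> P B \<longleftrightarrow> worm_less ord_zero C B" for B C :: "'l worm"
  proof
    assume "worm_class C \<in> P B"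
    then obtain C' where "worm_less ord_zero C' B" "worm_equiv C C'"
      unfolding P_def using worm_class_eq_iff by blast
    moreover from this have "worm_equiv C' C" "worm_equiv B B"
      by (metis worm_class_eq_iff)+
    ultimately show "worm_less ord_zero C B"
      using worm_less_cong by blast
  qed (auto simp: P_def)
  have field: "Field ?r = P Z"
    using refl unfolding r by (auto simp: P_def Field_def)
  have P_sub: "P B \<subseteq> P C" if "worm_less ord_zero B C" for B C :: "'l worm"
    using that worm_less_trans unfolding P_def by blast
  have o_r: "worm_o B = Restr ?r (P B)" and ofil: "wo_rel.ofilter ?r (P B)" if "P B \<subseteq> P Z" for B
  proof -
    show "worm_o B = Restr ?r (P B)"
      using that unfolding o r by blast
    have "under ?r p \<subseteq> P B" if p: "p \<in> P B" for p
    proof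
      fix q assume "q \<in> under ?r p"
      then have q: "(q, p) \<in> worm_order" "q \<in> P Z"
        by (auto simp: under_def r)
      obtain C C' where C: "p = worm_class C" "q = worm_class C'"
        using subsetD[OF \<open>P B \<subseteq> P Z\<close> \<open>p \<in> P B\<close>] q(2) unfolding P_def by blast
      with q have "worm_less ord_zero C' C \<or> worm_equiv C' C"
        using worm_order_iff by blast
      moreover have "worm_less ord_zero C B"
        using \<open>p \<in> P B\<close> unfolding C P_iff .
      ultimately have "worm_less ord_zero C' B \<or> worm_class C' = worm_class C"
        using worm_less_trans worm_class_eq_iff by blast
      then show "q \<in> P B"
        using \<open>p \<in> P B\<close> P_iff C by metis
    qed
    then show "wo_rel.ofilter ?r (P B)"
      using that wo by (simp add: wo_rel.ofilter_def wo_rel_def field)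
  qed
  \<comment> \<open>Strict because the class of \<open>D\<close> lies in \<open>P Z\<close>, but by
    irreflexivity not in \<open>P D\<close>.\<close>
  have "P D \<subset> P Z"
    using P_sub[OF D(1)] D P_iff by blast
  then have "worm_o D <o ?r"
    using ofilter_subset_ordLess[OF wo ofil ofil, of D Z] o_r[of D] o_r[of Z] by simp
  then have "\<not> ?r \<le>o worm_o D" "Well_order (worm_o D)"
    using not_ordLess_ordLeq by (auto simp: ordLess_def)
  then obtain B where B: "B \<in> X" "\<not> worm_o B \<le>o worm_o D"
    using sup unfolding is_osup_def by blast
  have BZ: "P B \<subseteq> P Z" and DZ: "P D \<subseteq> P Z"
    using P_sub X[OF B(1)] D(1) by blast+
  have "\<not> P B \<subseteq> P D"
    using ofilter_subset_ordLeq[OF wo ofil[OF BZ] ofil[OF DZ]] B(2) o_r[OF BZ] o_r[OF DZ] by simp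
  moreover have "P B = P D" if "worm_equiv B D"
  proof -
    have eq: "worm_equiv D B" "worm_equiv C C" for C :: "'l worm"
      using that worm_class_eq_iff by metis+
    then have "worm_less ord_zero C B \<longleftrightarrow> worm_less ord_zero C D" for C
      using worm_less_cong[OF eq(2) that] worm_less_cong[OF eq(2) eq(1)] by blast
    then show ?thesis
      by (simp add: P_def)
  qed
  ultimately have no: "\<not> worm_less ord_zero B D" "\<not> worm_equiv B D"
    using P_sub by blast+
  \<comment> \<open>Both classes lie in the total order below \<open>Z\<close>. Since
    \<open>P B\<close> is not contained in \<open>P D\<close>, only \<open>D\<close> below
    \<open>B\<close> remains.\<close>
  have "worm_class B \<in> Field ?r" "worm_class D \<in> Field ?r"
    unfolding field using P_iff X[OF B(1)] D(1) by blast+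
  then have "(worm_class B, worm_class D) \<in> worm_order \<or> (worm_class D, worm_class B) \<in> worm_order"
    using lin refl[of B] unfolding total_on_def by (cases "worm_class B = worm_class D") (auto simp: o)
  then have "worm_less ord_zero D B"
    using no unfolding worm_order_iff by (auto simp: worm_equiv_def)
  with B(1) show ?thesis
    using that by blast
qed

section \<open>From cofinality to implications between relativized worms\<close>

lemma map_worm_power: "map_worm g ((WDia \<eta> ^^ k) WTop) = (WDia (g \<eta>) ^^ k) WTop"
  by (induction k) simp_all

lemma modalities_power: "\<xi> \<in> modalities ((WDia \<eta> ^^ k) WTop) \<Longrightarrow> \<xi> = \<eta>"
  by (induction k) auto

text \<open>Cofinality speaks about heads shifted down by \<gamma>. The comparison is found among
  shifted worms, and relativization along the inverse shift carries it back while inserting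
  \<psi>.\<close>

lemma Q_above_power:
  fixes \<gamma> \<zeta> :: "'l::wellorder"
  assumes less: "\<gamma> < \<zeta>"
    and mod: "\<And>A. A \<in> \<tau> \<Longrightarrow> \<forall>\<xi>\<in>modalities (WDia \<gamma> A). \<xi> < \<zeta>"
    and cof: "cofinal_in \<gamma> (WDia \<gamma> ` \<tau>) (WDia \<zeta> WTop)"
    and \<eta>: "\<gamma> \<le> \<eta>" "\<eta> < \<zeta>"
  obtains A where "A \<in> \<tau>" "GLP (Imp (Q (WDia \<gamma> A) \<psi>) (Q (WDia \<gamma> ((WDia \<eta> ^^ k) WTop)) \<psi>))"
proof -
  let ?g = "left_minus \<gamma>" and ?H = "\<lambda>A. head \<gamma> (WDia \<gamma> A)"
  let ?D = "map_worm ?g ((WDia \<eta> ^^ k) WTop)"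
  have g_mono: "?g \<xi> < ?g \<xi>'" if "\<gamma> \<le> \<xi>" "\<xi> < \<xi>'" for \<xi> \<xi>'
    using that rank_from_mono left_minus_eq by (metis less_imp_le order_trans)
  have g_onto: "\<exists>\<xi>. \<gamma> \<le> \<xi> \<and> ?g \<xi> = \<delta>" if "\<delta> < ?g \<zeta>" for \<delta>
    using that rank_from_onto[of \<delta> \<gamma> \<zeta>] left_minus_eq less by (metis less_imp_le)
  have g_zero: "?g \<gamma> = ord_zero"
    by (simp add: left_minus_eq rank_from_self)
  \<comment> \<open>The inverse shift. Its monotonicity is obtained below \<open>?g \<zeta>\<close>,
    where \<open>g_onto\<close> supplies preimages; this is the bound \<open>b\<close> of the
    relativization.\<close>
  define h where "h = inv_into {\<gamma>..} ?g"
  have "inj_on ?g {\<gamma>..}"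
    unfolding inj_on_def using g_mono by (metis atLeast_iff less_irrefl neq_iff)
  then have h: "h (?g \<xi>) = \<xi>" if "\<gamma> \<le> \<xi>" for \<xi>
    using that by (simp add: h_def)
  have h_mono: "h \<delta> < h \<delta>'" if lt: "\<delta> < \<delta>'" "\<delta>' < ?g \<zeta>" for \<delta> \<delta>'
  proof -
    obtain \<xi> \<xi>' where "\<gamma> \<le> \<xi>" "?g \<xi> = \<delta>" "\<gamma> \<le> \<xi>'" "?g \<xi>' = \<delta>'"
      using g_onto[OF less_trans[OF lt]] g_onto[OF lt(2)] by blast
    then show ?thesis
      using lt(1) g_mono[of \<xi>' \<xi>] h by (metis less_asym neq_iff)
  qed
  have H_mod: "\<gamma> \<le> \<xi>" "\<xi> < \<zeta>" if "A \<in> \<tau>" "\<xi> \<in> modalities (?H A)" for A \<xi>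
    using modalities_head[OF that(2)] mod[OF that(1)] by auto
  have less_Z: "worm_less ord_zero (map_worm ?g B) (WDia (?g \<zeta>) WTop)"
    if "\<And>\<xi>. \<xi> \<in> modalities B \<Longrightarrow> \<gamma> \<le> \<xi> \<and> \<xi> < \<zeta>" for B
  proof -
    have "\<forall>\<delta>\<in>modalities (WDia ord_zero (map_worm ?g B)). \<delta> < ?g \<zeta>"
      using that g_mono[of _ \<zeta>] less by (auto simp: worm.set_map simp flip: g_zero)
    from dia_imp_worm[OF this] show ?thesis
      by (simp add: worm_less_def)
  qed
  have "worm_o_at \<gamma> (WDia \<zeta> WTop) = worm_o (WDia (?g \<zeta>) WTop)"
    using less_imp_le[OF less] by (simp add: worm_o_at_def shift_down_def)
  moreover have "worm_o_at \<gamma> ` WDia \<gamma> ` \<tau> = worm_o ` (\<lambda>A. map_worm ?g (?H A)) ` \<tau>"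
    by (simp add: image_image worm_o_at_def shift_down_def)
  ultimately have sup: "is_osup (worm_o ` (\<lambda>A. map_worm ?g (?H A)) ` \<tau>) (worm_o (WDia (?g \<zeta>) WTop))"
    using cof by (simp add: cofinal_in_def)
  have D: "worm_less ord_zero ?D (WDia (?g \<zeta>) WTop)"
  proof (rule less_Z)
    fix \<xi> assume "\<xi> \<in> modalities ((WDia \<eta> ^^ k) WTop)"
    then have "\<xi> = \<eta>"
      by (rule modalities_power)
    with \<eta> show "\<gamma> \<le> \<xi> \<and> \<xi> < \<zeta>"
      by simp
  qed
  have "\<not> worm_less ord_zero ?D ?D"
    unfolding map_worm_power by (rule power_worm_irrefl)
  then obtain B where "B \<in> (\<lambda>A. map_worm ?g (?H A)) ` \<tau>" "worm_less ord_zero ?D B"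
  proof (rule cofinal_above[OF sup _ D, rotated])
    fix B assume "B \<in> (\<lambda>A. map_worm ?g (?H A)) ` \<tau>"
    then obtain A where A: "A \<in> \<tau>" "B = map_worm ?g (?H A)"
      by (rule imageE)
    show "worm_less ord_zero B (WDia (?g \<zeta>) WTop)"
      unfolding A(2) using less_Z H_mod[OF A(1)] by blast
  qed
  then obtain A where A: "A \<in> \<tau>" "worm_less ord_zero ?D (map_worm ?g (?H A))"
    by (elim imageE) simp
  \<comment> \<open>The leading \<gamma> shifts to \<open>ord_zero\<close>, the diamond in the
    definition of the order on shifted worms.\<close>
  let ?E = "WDia \<gamma> ((WDia \<eta> ^^ k) WTop)" and ?R = "\<lambda>B. relativize h (?g \<zeta>) \<psi> (fm_of (map_worm ?g B))"
  have "GLP (Imp (fm_of (map_worm ?g (?H A))) (fm_of (map_worm ?g ?E)))"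
    using A(2) by (simp add: worm_less_def g_zero)
  then have "GLP (relativize h (?g \<zeta>) \<psi> (Imp (fm_of (map_worm ?g (?H A))) (fm_of (map_worm ?g ?E))))"
    by (rule GLP_relativize) (rule h_mono)
  then have R: "GLP (Imp (?R (?H A)) (?R ?E))"
    by (simp only: relativize.simps)
  have g_h: "?g \<xi> < ?g \<zeta> \<and> h (?g \<xi>) = \<xi>" if "\<gamma> \<le> \<xi>" "\<xi> < \<zeta>" for \<xi>
    using that h g_mono by simp
  have "GLP (Imp (Q (?H A) \<psi>) (?R (?H A)))"
    using relativize_worm[of "?H A" ?g "?g \<zeta>" h \<psi>] g_h H_mod[OF A(1)] by blast
  moreover have "?g \<xi> < ?g \<zeta> \<and> h (?g \<xi>) = \<xi>" if "\<xi> \<in> modalities ?E" for \<xi>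
    using that modalities_power[of \<xi> k \<eta>] \<eta> less by (intro g_h) auto
  then have "GLP (Imp (?R ?E) (Q ?E \<psi>))"
    using relativize_worm[of ?E ?g "?g \<zeta>" h \<psi>] by blast
  ultimately have "GLP (Imp (Q (?H A) \<psi>) (Q ?E \<psi>))"
    using R GLP_trans by blast
  then have "GLP (Imp (Q (WDia \<gamma> A) \<psi>) (Q ?E \<psi>))"
    by (rule GLP_trans[OF GLP_Q_head])
  with A(1) show ?thesis
    by (rule that)
qed

theorem theorem7:
  fixes \<gamma> \<zeta> :: "'l::wellorder" and \<psi> :: "'l fm" and \<tau> :: "'l worm set"
  assumes "\<gamma> < \<zeta>"
    and "\<And>A. A \<in> \<tau> \<Longrightarrow> \<forall>\<xi>\<in>modalities (WDia \<gamma> A). \<xi> < \<zeta>"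
    and "cofinal_in \<gamma> (WDia \<gamma> ` \<tau>) (WDia \<zeta> WTop)"
  shows "equiv_dia \<gamma> {Dia \<zeta> \<psi>} ((\<lambda>A. Q A \<psi>) ` (WDia \<gamma> ` \<tau>))"
  unfolding equiv_dia_def
proof (intro allI iffI)
  fix \<chi>
  let ?Q = "(\<lambda>A. Q A \<psi>) ` (WDia \<gamma> ` \<tau>)"
  assume "entails {Dia \<zeta> \<psi>} (Dia \<gamma> \<chi>)"
  then have "GLP (Imp (Dia \<zeta> \<psi>) (Dia \<gamma> \<chi>))"
    using mcs_entails entails_subset unfolding GLP_iff_mcs by (metis empty_subsetI insert_subset mcs_simps(2))
  then obtain \<eta> k where \<eta>: "\<gamma> \<le> \<eta>" "\<eta> < \<zeta>" "GLP (Imp (Q ((WDia \<eta> ^^ k) WTop) \<psi>) (Dia \<gamma> \<chi>))"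
    by (rule dia_conservative[OF assms(1)])
  obtain A where A: "A \<in> \<tau>" "GLP (Imp (Q (WDia \<gamma> A) \<psi>) (Q (WDia \<gamma> ((WDia \<eta> ^^ k) WTop)) \<psi>))"
    by (rule Q_above_power[OF assms \<eta>(1,2)])
  have "GLP (Imp (And \<psi> (Q ((WDia \<eta> ^^ k) WTop) \<psi>)) (Dia \<gamma> \<chi>))"
    by (rule GLP_taut1[OF \<eta>(3)]) auto
  \<comment> \<open>The leading \<gamma> of the worm puts a second \<open>Dia \<gamma>\<close> in
    front, which transitivity then contracts.\<close>
  then have "GLP (Imp (Q (WDia \<gamma> ((WDia \<eta> ^^ k) WTop)) \<psi>) (Dia \<gamma> (Dia \<gamma> \<chi>)))"
    by (simp add: GLP_dia_mono)
  then have "GLP (Imp (Q (WDia \<gamma> A) \<psi>) (Dia \<gamma> \<chi>))"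
    using GLP_trans[OF A(2)] GLP_trans GLP_dia_trans by blast
  then show "entails ?Q (Dia \<gamma> \<chi>)"
    using A(1) entails_mp entails_GLP entails_mem by (metis image_eqI)
next
  fix \<chi>
  assume "entails ((\<lambda>A. Q A \<psi>) ` (WDia \<gamma> ` \<tau>)) (Dia \<gamma> \<chi>)"
  then obtain l where l: "set l \<subseteq> (\<lambda>A. Q A \<psi>) ` (WDia \<gamma> ` \<tau>)" "GLP (Imp (Conj l) (Dia \<gamma> \<chi>))"
    by (auto simp: entails_def)
  have "Dia \<gamma> \<chi> \<in> x" if mx: "mcs x" and x: "Dia \<zeta> \<psi> \<in> x" for x
  proof -
    have "set l \<subseteq> x"
      using l(1) mcs_mp[OF mx dia_imp_Q x] assms(2) by blast
    then show ?thesis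
      using mcs_mp[OF mx l(2)] mx by simp
  qed
  then have "GLP (Imp (Dia \<zeta> \<psi>) (Dia \<gamma> \<chi>))"
    using GLP_iff_mcs mcs_simps(2) by blast
  then show "entails {Dia \<zeta> \<psi>} (Dia \<gamma> \<chi>)"
    using entails_mp entails_GLP entails_mem by blast
qed

end
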